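(* For each $\varepsilon>0$ and $v_0\ge0$ there exist constants $A,B>0$ such that for all $n\ge1$ and all $v\in[0,v_0]$, \[\mathbb P\big(T((0,0),(n,\lceil vn\rceil))\le n(\Lambda(v)-\varepsilon)\big)\le A\exp(-Bn).\] The same holds for the directed (SJ) model, with $T$ and $\Lambda$ replaced by $T_{dir}$ and $\Lambda_{dir}$, when $G$ is a two-point (Bernoulli-type) distribution.
   Context: Model: Let $G$ be any probability measure on $[0,\infty)$. In $\mathbb Z^2$, every vertical edge has weight $1$ and every horizontal edge an independent random weight with law $G$; the passage time of a nearest-neighbour path is the sum of its edge weights; $T(u,w)$ is the infimum over all paths from $u$ to $w$ and $\Lambda(v)=\lim_n\frac1nT((0,0),(n,\lceil vn\rceil))$ for $v\ge0$ (a.s. limit, deterministic). Directed (SJ) model: same weights, but $T_{dir}(u,w)$ is the infimum only over directed paths (all steps equal to $(1,0)$ or $(0,1)$), and $\Lambda_{dir}(v)=\lim_n\frac1nT_{dir}((0,0),(n,\lceil vn\rceil))$ (a.s. limit, deterministic). *)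

theory Defs
  imports "HOL-Probability.Probability"
begin

type_synonym site = "int \<times> int"

text \<open>Horizontal edge between (x,y) and (x+1,y) is indexed by (x,y).
  A configuration assigns a weight to every horizontal edge.\<close>

definition nn_step :: "site \<Rightarrow> site \<Rightarrow> bool" where
  "nn_step p q \<longleftrightarrow> \<bar>fst p - fst q\<bar> + \<bar>snd p - snd q\<bar> = 1"

definition dir_step :: "site \<Rightarrow> site \<Rightarrow> bool" where
  "dir_step p q \<longleftrightarrow> q = (fst p + 1, snd p) \<or> q = (fst p, snd p + 1)"

definition edge_weight :: "(site \<Rightarrow> real) \<Rightarrow> site \<Rightarrow> site \<Rightarrow> real" where
  "edge_weight \<omega> p q = (if snd p = snd q then \<omega> (min (fst p) (fst q), snd p) else 1)"

fun ptime :: "(site \<Rightarrow> real) \<Rightarrow> site list \<Rightarrow> real" where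
  "ptime \<omega> (p # q # r) = edge_weight \<omega> p q + ptime \<omega> (q # r)"
| "ptime \<omega> _ = 0"

definition is_path :: "(site \<Rightarrow> site \<Rightarrow> bool) \<Rightarrow> site list \<Rightarrow> site \<Rightarrow> site \<Rightarrow> bool" where
  "is_path S xs u w \<longleftrightarrow> xs \<noteq> [] \<and> hd xs = u \<and> last xs = w \<and> successively S xs"

definition passage :: "(site \<Rightarrow> real) \<Rightarrow> site \<Rightarrow> site \<Rightarrow> real" where
  "passage \<omega> u w = Inf (ptime \<omega> ` {xs. is_path nn_step xs u w})"

definition passage_dir :: "(site \<Rightarrow> real) \<Rightarrow> site \<Rightarrow> site \<Rightarrow> real" where
  "passage_dir \<omega> u w = Inf (ptime \<omega> ` {xs. is_path dir_step xs u w})"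

definition config :: "real measure \<Rightarrow> (site \<Rightarrow> real) measure" where
  "config G = (\<Pi>\<^sub>M e\<in>UNIV. G)"

definition endpoint :: "real \<Rightarrow> nat \<Rightarrow> site" where
  "endpoint v n = (int n, \<lceil>v * real n\<rceil>)"

definition Lambda :: "real measure \<Rightarrow> real \<Rightarrow> real" where
  "Lambda G v = (THE c. AE \<omega> in config G.
      (\<lambda>n. passage \<omega> (0,0) (endpoint v n) / real n) \<longlonglongrightarrow> c)"

definition Lambda_dir :: "real measure \<Rightarrow> real \<Rightarrow> real" where
  "Lambda_dir G v = (THE c. AE \<omega> in config G.
      (\<lambda>n. passage_dir \<omega> (0,0) (endpoint v n) / real n) \<longlonglongrightarrow> c)"

end

theory Submission
  imports Defs
begin

text \<open>
  Vertical edges have weight exactly 1, so an optimal path may be taken to cross every column of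
  horizontal edges once, even in the undirected model. The passage time to abscissa \<open>n\<close> is thus
  a function of \<open>n\<close> independent columns. Resampling a single column increases it by at most the
  cost of crossing the fresh column near the old crossing height. In the undirected model this
  cost has exponential moments for every \<open>G\<close>, because a path can move to the nearest light edge;
  in the directed model it is one weight.

  Integrating out the columns one at a time and symmetrising each of them bounds the moment
  generating function of the centred passage time by \<open>(1 + C \<lambda>\<^sup>2) ^ n\<close>, uniformly in the endpoint.
  Markov's inequality gives exponential concentration around the mean, which with Fekete's lemma
  and the Borel--Cantelli lemma identifies \<open>\<Lambda>\<close> as the limit of the normalised means. Approximate
  subadditivity also gives that the mean is at least \<open>n \<Lambda> - 1\<close>, whence the lower tail bound.

  Directed paths cannot step down, so there subadditivity is available only for the endpoints
  \<open>\<lfloor>v n\<rfloor>\<close>. Replacing \<open>\<lceil>v n\<rceil>\<close> by \<open>\<lfloor>v n\<rfloor>\<close> costs at most the maximum of a centred random walk,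
  which exceeds \<open>\<epsilon> n\<close> with exponentially small probability.
\<close>

section \<open>Exponential moments of functions of independent variables\<close>

text \<open>Termwise comparison of power series: \<open>r ^ n \<le> r\<^sup>2\<close> for even
  \<open>n \<ge> 2\<close>, and even powers of \<open>x\<close> are nonnegative. The constant term
  accounts for the 1. This is the source of the quadratic dependence on \<open>l / s\<close>
  below.\<close>

lemma cosh_mult_le:
  fixes r x :: real
  assumes "\<bar>r\<bar> \<le> 1"
  shows "cosh (r * x) \<le> 1 + r\<^sup>2 * cosh x"
proof -
  define c where "c y n = (if even n then y ^ n / fact n else 0)" for y :: real and n :: nat
  have c: "c y sums cosh y" for y
    using cosh_converges[of y] unfolding c_def by (simp add: divide_inverse mult.commute if_distrib cong: if_cong)
  have one: "(\<lambda>n. if n = 0 then 1 else 0 :: real) sums 1"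
    using sums_single[of 0 "\<lambda>_. 1::real"] by simp
  have "c (r * x) n \<le> (if n = 0 then 1 else 0) + r\<^sup>2 * c x n" for n
  proof (cases "even n \<and> n \<noteq> 0")
    case True
    then have n: "2 \<le> n" "even n" by (auto elim!: evenE)
    have "r ^ n = \<bar>r\<bar> ^ n" using n by (simp add: power_even_abs)
    also have "\<dots> \<le> \<bar>r\<bar> ^ 2" using n assms by (intro power_decreasing) auto
    finally have "r ^ n \<le> r\<^sup>2" by simp
    moreover have "0 \<le> x ^ n" using n by (simp add: zero_le_even_power)
    ultimately have "r ^ n * (x ^ n / fact n) \<le> r\<^sup>2 * (x ^ n / fact n)"
      by (intro mult_right_mono) auto
    then show ?thesis using n by (simp add: c_def power_mult_distrib)
  qed (auto simp: c_def)
  then show ?thesis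
    using sums_le[OF _ c sums_add[OF one sums_mult[OF c]]] by blast
qed

text \<open>Jensen's inequality from the tangent line of the exponential at the mean. As a
  nonnegative integral the right side may be infinite.\<close>

lemma (in prob_space) exp_integral_le_nn_integral:
  fixes h :: "'a \<Rightarrow> real"
  assumes [simp, measurable]: "integrable M h"
  shows "ennreal (exp (\<integral>x. h x \<partial>M)) \<le> (\<integral>\<^sup>+x. ennreal (exp (h x)) \<partial>M)"
proof (cases "integrable M (\<lambda>x. exp (h x))")
  case True
  define m where "m = (\<integral>x. h x \<partial>M)"
  have "exp m * (1 + (y - m)) \<le> exp y" for y
  proof -
    have "exp m * (1 + (y - m)) \<le> exp m * exp (y - m)"
      by (intro mult_left_mono exp_ge_add_one_self) auto
    then show ?thesis by (simp add: exp_diff)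
  qed
  then have "(\<integral>x. exp m * (1 + (h x - m)) \<partial>M) \<le> (\<integral>x. exp (h x) \<partial>M)"
    using True by (intro integral_mono) auto
  also have "(\<integral>x. exp m * (1 + (h x - m)) \<partial>M) = exp m"
    by (simp add: m_def prob_space)
  finally show ?thesis
    using True unfolding m_def by (subst nn_integral_eq_integral) (auto simp: ennreal_leI)
next
  case False
  then have "(\<integral>\<^sup>+x. ennreal (exp (h x)) \<partial>M) = \<infinity>"
    by (auto simp: integrable_iff_bounded simp flip: top.not_eq_extremum)
  then show ?thesis by simp
qed

text \<open>Symmetrising turns the exponential of a difference into a hyperbolic cosine, whose
  first-order term vanishes.\<close>

lemma (in prob_space) nn_integral_exp_diff_le:
  fixes u :: "'a \<Rightarrow> real"
  assumes [measurable]: "u \<in> borel_measurable M"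
    and \<kappa>: "0 \<le> \<kappa>" "\<And>y'. y' \<in> space M \<Longrightarrow> (\<integral>\<^sup>+y. ennreal (exp (s * (u y - u y'))) \<partial>M) \<le> ennreal \<kappa>"
    and "0 < s" "\<bar>l\<bar> \<le> s"
  shows "(\<integral>\<^sup>+y'. \<integral>\<^sup>+y. ennreal (exp (l * (u y - u y'))) \<partial>M \<partial>M) \<le> ennreal (1 + (l / s)\<^sup>2 * \<kappa>)"
proof -
  interpret P: pair_prob_space M M ..
  define I where "I t = (\<integral>\<^sup>+y'. \<integral>\<^sup>+y. ennreal (exp (t * (u y - u y'))) \<partial>M \<partial>M)" for t
  define J where "J t = (\<integral>\<^sup>+y'. \<integral>\<^sup>+y. ennreal (exp (t * (u y - u y')) + exp (- t * (u y - u y'))) \<partial>M \<partial>M)" for t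
  \<comment> \<open>\<open>y\<close> and \<open>y'\<close> are independent with the same law, so
    exchanging them flips the sign of \<open>t\<close>.\<close>
  have sym: "I (- t) = I t" for t
  proof -
    have "I (- t) = (\<integral>\<^sup>+y'. \<integral>\<^sup>+y. ennreal (exp (t * (u y' - u y))) \<partial>M \<partial>M)"
      unfolding I_def by (intro nn_integral_cong) (simp add: algebra_simps)
    also have "\<dots> = I t"
      unfolding I_def by (rule P.Fubini') measurable
    finally show ?thesis .
  qed
  have J: "J t = 2 * I t" for t
  proof -
    have "J t = (\<integral>\<^sup>+y'. \<integral>\<^sup>+y. ennreal (exp (t * (u y - u y'))) + ennreal (exp (- t * (u y - u y'))) \<partial>M \<partial>M)"
      unfolding J_def by (intro nn_integral_cong) (simp add: ennreal_plus)
    also have "\<dots> = (\<integral>\<^sup>+y'. (\<integral>\<^sup>+y. ennreal (exp (t * (u y - u y'))) \<partial>M) + (\<integral>\<^sup>+y. ennreal (exp (- t * (u y - u y'))) \<partial>M) \<partial>M)"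
      by (intro nn_integral_cong nn_integral_add) measurable
    also have "\<dots> = I t + I (- t)"
      unfolding I_def by (intro nn_integral_add) measurable
    finally have "J t = I t + I (- t)" .
    then show ?thesis by (simp add: sym mult_2)
  qed
  have "I s \<le> (\<integral>\<^sup>+y'. ennreal \<kappa> \<partial>M)"
    unfolding I_def by (intro nn_integral_mono \<kappa>)
  then have Is: "I s \<le> ennreal \<kappa>" by (simp add: emeasure_space_1)
  have "J l \<le> (\<integral>\<^sup>+y'. \<integral>\<^sup>+y. 2 + ennreal ((l / s)\<^sup>2) * ennreal (exp (s * (u y - u y')) + exp (- s * (u y - u y'))) \<partial>M \<partial>M)"
    unfolding J_def
  proof (intro nn_integral_mono)
    fix y' y
    have "cosh (l * (u y - u y')) \<le> 1 + (l / s)\<^sup>2 * cosh (s * (u y - u y'))"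
      using cosh_mult_le[of "l / s" "s * (u y - u y')"] assms by simp
    then have "ennreal (exp (l * (u y - u y')) + exp (- l * (u y - u y')))
        \<le> ennreal (2 + (l / s)\<^sup>2 * (exp (s * (u y - u y')) + exp (- s * (u y - u y'))))"
      by (intro ennreal_leI) (simp add: cosh_field_def)
    then show "ennreal (exp (l * (u y - u y')) + exp (- l * (u y - u y'))) \<le> 2 + ennreal ((l / s)\<^sup>2) * ennreal (exp (s * (u y - u y')) + exp (- s * (u y - u y')))"
      by (subst (asm) ennreal_plus) (auto simp: ennreal_mult)
  qed
  also have "\<dots> = 2 + ennreal ((l / s)\<^sup>2) * J s"
    unfolding J_def by (simp add: nn_integral_add nn_integral_cmult emeasure_space_1 del: ennreal_plus)
  also have "\<dots> \<le> 2 + ennreal ((l / s)\<^sup>2) * (2 * ennreal \<kappa>)"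
    unfolding J by (intro add_left_mono mult_left_mono Is) auto
  also have "\<dots> = 2 * ennreal (1 + (l / s)\<^sup>2 * \<kappa>)"
    using \<kappa>(1) by (simp add: ennreal_mult ennreal_plus algebra_simps)
  finally have "2 * I l \<le> 2 * ennreal (1 + (l / s)\<^sup>2 * \<kappa>)" by (simp add: J)
  then show ?thesis
    unfolding I_def by (simp add: ennreal_mult_le_mult_iff)
qed

text \<open>Jensen's inequality in \<open>y'\<close> replaces the mean by an independent copy, which
  can only increase the exponential moment; the symmetrised bound then applies.\<close>

lemma (in prob_space) nn_integral_exp_centred_le:
  fixes u :: "'a \<Rightarrow> real"
  assumes u[measurable]: "integrable M u"
    and \<kappa>: "0 \<le> \<kappa>" "\<And>y'. y' \<in> space M \<Longrightarrow> (\<integral>\<^sup>+y. ennreal (exp (s * (u y - u y'))) \<partial>M) \<le> ennreal \<kappa>"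
    and "0 < s" "\<bar>l\<bar> \<le> s"
  shows "(\<integral>\<^sup>+y. ennreal (exp (l * (u y - (\<integral>y'. u y' \<partial>M)))) \<partial>M) \<le> ennreal (1 + (l / s)\<^sup>2 * \<kappa>)"
proof -
  interpret P: pair_prob_space M M ..
  have [measurable]: "u \<in> borel_measurable M" using u by auto
  have "(\<integral>\<^sup>+y. ennreal (exp (l * (u y - (\<integral>y'. u y' \<partial>M)))) \<partial>M)
      \<le> (\<integral>\<^sup>+y. \<integral>\<^sup>+y'. ennreal (exp (l * (u y - u y'))) \<partial>M \<partial>M)"
  proof (intro nn_integral_mono)
    fix y
    have "l * (u y - (\<integral>y'. u y' \<partial>M)) = (\<integral>y'. l * (u y - u y') \<partial>M)"
      using u by (simp add: prob_space)
    then show "ennreal (exp (l * (u y - (\<integral>y'. u y' \<partial>M)))) \<le> (\<integral>\<^sup>+y'. ennreal (exp (l * (u y - u y'))) \<partial>M)"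
      using exp_integral_le_nn_integral[of "\<lambda>y'. l * (u y - u y')"] u by (simp add: prob_space)
  qed
  also have "\<dots> = (\<integral>\<^sup>+y'. \<integral>\<^sup>+y. ennreal (exp (l * (u y - u y'))) \<partial>M \<partial>M)"
    by (rule P.Fubini') measurable
  also have "\<dots> \<le> ennreal (1 + (l / s)\<^sup>2 * \<kappa>)"
    using assms by (intro nn_integral_exp_diff_le) auto
  finally show ?thesis .
qed

text \<open>Martingale method: with \<open>g\<close> the average of \<open>f\<close> over the new
  coordinate, the fluctuation splits into \<open>f - g\<close>, centred in that coordinate, and the
  fluctuation of \<open>g\<close>, handled by induction. Each coordinate contributes one factor.
  Boundedness by \<open>b\<close> supplies integrability, while the final bound is free of
  \<open>b\<close>, so that truncations can be removed later.\<close>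

lemma nn_integral_exp_centred_PiM_le:
  fixes N :: "'a measure" and f :: "('i \<Rightarrow> 'a) \<Rightarrow> real"
  assumes N: "prob_space N" and "finite I"
    and "f \<in> borel_measurable (Pi\<^sub>M I (\<lambda>_. N))"
    and "\<And>x. x \<in> space (Pi\<^sub>M I (\<lambda>_. N)) \<Longrightarrow> \<bar>f x\<bar> \<le> b"
    and \<kappa>: "0 \<le> \<kappa>" and "\<And>i x. i \<in> I \<Longrightarrow> x \<in> space (Pi\<^sub>M I (\<lambda>_. N)) \<Longrightarrow>
          (\<integral>\<^sup>+t. ennreal (exp (s * (f (x(i := t)) - f x))) \<partial>N) \<le> ennreal \<kappa>"
    and s: "0 < s" "\<bar>l\<bar> \<le> s"
  shows "(\<integral>\<^sup>+x. ennreal (exp (l * (f x - (\<integral>x. f x \<partial>Pi\<^sub>M I (\<lambda>_. N))))) \<partial>Pi\<^sub>M I (\<lambda>_. N))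
     \<le> ennreal ((1 + (l / s)\<^sup>2 * \<kappa>) ^ card I)"
  using assms(2,3,4,6)
proof (induction I arbitrary: f rule: finite_induct)
  case empty
  interpret prob_space "Pi\<^sub>M {} (\<lambda>_. N) :: ('i \<Rightarrow> 'a) measure" by (intro prob_space_PiM N)
  show ?case
    by (simp add: PiM_empty lebesgue_integral_count_space_finite nn_integral_count_space_finite)
next
  case (insert j I)
  interpret N: prob_space N by (rule N)
  interpret NN: pair_prob_space N N ..
  interpret Q: product_prob_space "\<lambda>_. N" I by standard
  interpret P: prob_space "Pi\<^sub>M I (\<lambda>_. N)" by (intro prob_space_PiM N)
  interpret P': prob_space "Pi\<^sub>M (insert j I) (\<lambda>_. N)" by (intro prob_space_PiM N)
  note [measurable] = insert.prems(1)
  have upd: "x(j := y) \<in> space (Pi\<^sub>M (insert j I) (\<lambda>_. N))"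
    if "x \<in> space (Pi\<^sub>M I (\<lambda>_. N))" "y \<in> space N" for x y
    using that by (auto simp: space_PiM PiE_iff extensional_def)
  have meas_j [measurable]: "(\<lambda>y. f (x(j := y))) \<in> borel_measurable N"
    if [simp]: "x \<in> space (Pi\<^sub>M I (\<lambda>_. N))" for x
    by measurable
  have int_j: "integrable N (\<lambda>y. f (x(j := y)))" if "x \<in> space (Pi\<^sub>M I (\<lambda>_. N))" for x
    using that insert.prems(2) upd
    by (intro N.integrable_const_bound[where B=b]) auto
  define g where "g x = (\<integral>y. f (x(j := y)) \<partial>N)" for x
  have g_meas[measurable]: "g \<in> borel_measurable (Pi\<^sub>M I (\<lambda>_. N))"
    unfolding g_def by measurable
  have g_bound: "\<bar>g x\<bar> \<le> b" if x: "x \<in> space (Pi\<^sub>M I (\<lambda>_. N))" for x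
  proof -
    have "\<bar>g x\<bar> \<le> (\<integral>y. \<bar>f (x(j := y))\<bar> \<partial>N)"
      unfolding g_def by (rule integral_abs_bound)
    also have "\<dots> \<le> (\<integral>y. b \<partial>N)"
      using int_j[OF x] by (intro integral_mono insert.prems(2) upd x) auto
    finally show ?thesis by (simp add: N.prob_space)
  qed
  \<comment> \<open>Averaging over coordinate \<open>j\<close> preserves the resampling bound in the
    other coordinates: Jensen moves the average outside the exponential, Fubini swaps the two
    integrals, and the hypothesis on \<open>f\<close> holds for each fixed \<open>y\<close>.\<close>
  have g_diff: "(\<integral>\<^sup>+t. ennreal (exp (s * (g (x(i := t)) - g x))) \<partial>N) \<le> ennreal \<kappa>"
    if i: "i \<in> I" and x: "x \<in> space (Pi\<^sub>M I (\<lambda>_. N))" for i x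
  proof -
    have ij: "i \<noteq> j" using i insert.hyps by auto
    have xi: "x(i := t) \<in> space (Pi\<^sub>M I (\<lambda>_. N))" if "t \<in> space N" for t
      using x i that by (auto simp: space_PiM PiE_iff extensional_def)
    have meas_ij[measurable]: "(\<lambda>(t, y). f (x(i := t, j := y))) \<in> borel_measurable (N \<Otimes>\<^sub>M N)"
    proof -
      have "(\<lambda>p. x(i := fst p, j := snd p)) \<in> measurable (N \<Otimes>\<^sub>M N) (Pi\<^sub>M (insert j I) (\<lambda>_. N))"
      proof (rule measurable_PiM_single')
        show "(\<lambda>p. (x(i := fst p, j := snd p)) k) \<in> measurable (N \<Otimes>\<^sub>M N) N" if "k \<in> insert j I" for k
          using x that by (auto simp: space_PiM PiE_iff)
        show "(\<lambda>p k. (x(i := fst p, j := snd p)) k) \<in> space (N \<Otimes>\<^sub>M N) \<rightarrow> (\<Pi>\<^sub>E i\<in>insert j I. space N)"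
          using x i by (auto simp: space_PiM PiE_iff space_pair_measure extensional_def split: if_splits)
      qed
      then show ?thesis by (simp add: case_prod_beta')
    qed
    have "(\<integral>\<^sup>+t. ennreal (exp (s * (g (x(i := t)) - g x))) \<partial>N)
        \<le> (\<integral>\<^sup>+t. \<integral>\<^sup>+y. ennreal (exp (s * (f (x(i := t, j := y)) - f (x(j := y))))) \<partial>N \<partial>N)"
    proof (intro nn_integral_mono)
      fix t assume "t \<in> space N"
      note int = int_j[OF xi[OF this]] int_j[OF x]
      have "s * (g (x(i := t)) - g x) = (\<integral>y. s * (f (x(i := t, j := y)) - f (x(j := y))) \<partial>N)"
        unfolding g_def using int by simp
      then show "ennreal (exp (s * (g (x(i := t)) - g x)))
          \<le> (\<integral>\<^sup>+y. ennreal (exp (s * (f (x(i := t, j := y)) - f (x(j := y))))) \<partial>N)"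
        unfolding g_def
        using N.exp_integral_le_nn_integral[of "\<lambda>y. s * (f (x(i := t, j := y)) - f (x(j := y)))"] int by simp
    qed
    also have "\<dots> = (\<integral>\<^sup>+y. \<integral>\<^sup>+t. ennreal (exp (s * (f (x(i := t, j := y)) - f (x(j := y))))) \<partial>N \<partial>N)"
    proof (rule NN.Fubini')
      note [measurable] = meas_j[OF x]
      show "(\<lambda>(y, t). ennreal (exp (s * (f (x(i := t, j := y)) - f (x(j := y)))))) \<in> borel_measurable (N \<Otimes>\<^sub>M N)"
        using measurable_pair_swap[OF meas_ij] by measurable
    qed
    also have "\<dots> \<le> (\<integral>\<^sup>+y. ennreal \<kappa> \<partial>N)"
    proof (intro nn_integral_mono)
      fix y assume y: "y \<in> space N"
      have "x(i := t, j := y) = x(j := y, i := t)" for t using ij by (rule fun_upd_twist)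
      then show "(\<integral>\<^sup>+t. ennreal (exp (s * (f (x(i := t, j := y)) - f (x(j := y))))) \<partial>N) \<le> ennreal \<kappa>"
        using insert.prems(3)[OF insertI2[OF i] upd[OF x y]] by presburger
    qed
    finally show ?thesis by (simp add: N.emeasure_space_1)
  qed
  let ?E = "\<integral>x. g x \<partial>Pi\<^sub>M I (\<lambda>_. N)" and ?K = "1 + (l / s)\<^sup>2 * \<kappa>"
  have IH: "(\<integral>\<^sup>+x. ennreal (exp (l * (g x - ?E))) \<partial>Pi\<^sub>M I (\<lambda>_. N)) \<le> ennreal (?K ^ card I)"
    by (rule insert.IH[OF g_meas g_bound g_diff])
  have "integrable (Pi\<^sub>M (insert j I) (\<lambda>_. N)) f"
    using insert.prems(2) by (intro P'.integrable_const_bound[where B=b]) auto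
  then have E: "(\<integral>x. f x \<partial>Pi\<^sub>M (insert j I) (\<lambda>_. N)) = ?E"
    unfolding g_def using insert.hyps by (intro Q.product_integral_insert) auto
  have "(\<integral>\<^sup>+x. ennreal (exp (l * (f x - ?E))) \<partial>Pi\<^sub>M (insert j I) (\<lambda>_. N))
      = (\<integral>\<^sup>+x. \<integral>\<^sup>+y. ennreal (exp (l * (f (x(j := y)) - ?E))) \<partial>N \<partial>Pi\<^sub>M I (\<lambda>_. N))"
    using insert.hyps by (intro Q.product_nn_integral_insert) measurable
  also have "\<dots> \<le> (\<integral>\<^sup>+x. ennreal (exp (l * (g x - ?E))) * ennreal ?K \<partial>Pi\<^sub>M I (\<lambda>_. N))"
  proof (intro nn_integral_mono)
    fix x assume x: "x \<in> space (Pi\<^sub>M I (\<lambda>_. N))"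
    \<comment> \<open>The factor with \<open>g x\<close> is constant in \<open>y\<close>; what
      remains is a centred exponential moment in one variable.\<close>
    have "(\<integral>\<^sup>+y. ennreal (exp (l * (f (x(j := y)) - ?E))) \<partial>N)
        = (\<integral>\<^sup>+y. ennreal (exp (l * (g x - ?E))) * ennreal (exp (l * (f (x(j := y)) - g x))) \<partial>N)"
      by (intro nn_integral_cong) (simp add: ennreal_mult[symmetric] exp_add[symmetric] algebra_simps)
    also have "\<dots> = ennreal (exp (l * (g x - ?E))) * (\<integral>\<^sup>+y. ennreal (exp (l * (f (x(j := y)) - g x))) \<partial>N)"
      using borel_measurable_integrable[OF int_j[OF x]] by (intro nn_integral_cmult) auto
    also have "\<dots> \<le> ennreal (exp (l * (g x - ?E))) * ennreal ?K"
      unfolding g_def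
    proof (intro mult_left_mono N.nn_integral_exp_centred_le int_j x \<kappa> s)
      fix y' assume y': "y' \<in> space N"
      show "(\<integral>\<^sup>+y. ennreal (exp (s * (f (x(j := y)) - f (x(j := y'))))) \<partial>N) \<le> ennreal \<kappa>"
        using insert.prems(3)[OF insertI1 upd[OF x y']] by (simp only: fun_upd_upd)
    qed auto
    finally show "(\<integral>\<^sup>+y. ennreal (exp (l * (f (x(j := y)) - ?E))) \<partial>N)
        \<le> ennreal (exp (l * (g x - ?E))) * ennreal ?K" .
  qed
  also have "\<dots> = (\<integral>\<^sup>+x. ennreal (exp (l * (g x - ?E))) \<partial>Pi\<^sub>M I (\<lambda>_. N)) * ennreal ?K"
    by (intro nn_integral_multc) measurable
  also have "\<dots> \<le> ennreal (?K ^ card I) * ennreal ?K"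
    by (intro mult_right_mono IH) auto
  also have "\<dots> = ennreal (?K ^ card (insert j I))"
    using insert.hyps \<kappa> by (subst ennreal_mult[symmetric]) (auto simp: mult.commute)
  finally show ?case unfolding E .
qed

section \<open>Crossing times\<close>

text \<open>Heights at which the last column may be crossed on the way to height \<open>k\<close>. A
  directed path starts at height 0 and never descends.\<close>

definition levels :: "bool \<Rightarrow> int \<Rightarrow> int set" where
  "levels d k = (if d then {0..k} else UNIV)"

text \<open>Alternative heights for crossing a resampled column that was crossed at height
  \<open>y\<close>. In the directed model a lower height may already have been passed and a higher
  one may overshoot the next crossing, so only \<open>y\<close> itself is safe.\<close>

definition detours :: "bool \<Rightarrow> int \<Rightarrow> int set" where
  "detours d y = (if d then {y} else UNIV)"

text \<open>The flag \<open>d\<close> selects the directed model. \<open>crossing d W n k\<close> is the cheapest cost of a path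
  from \<open>(0, 0)\<close> to \<open>(n, k)\<close> that crosses each column once, where \<open>W i y\<close> is the weight of the edge
  from \<open>(i, y)\<close> to \<open>(i + 1, y)\<close>.\<close>

primrec crossing :: "bool \<Rightarrow> (nat \<Rightarrow> int \<Rightarrow> real) \<Rightarrow> nat \<Rightarrow> int \<Rightarrow> real" where
  "crossing d W 0 k = dist k 0"
| "crossing d W (Suc n) k =
     (INF y\<in>levels d k. crossing d W n y + W n y + dist k y)"

declare crossing.simps(2) [simp del]

text \<open>For a negative \<open>k\<close> in the directed model and at least one column, the
  infimum in \<open>crossing\<close> runs over an empty set and carries no meaning.\<close>

abbreviation admissible :: "bool \<Rightarrow> int \<Rightarrow> bool" where
  "admissible d k \<equiv> d \<longrightarrow> 0 \<le> k"

lemma levels_nonempty_iff: "levels d k \<noteq> {} \<longleftrightarrow> admissible d k"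
  by (auto simp: levels_def)

lemma levels_admissible: "y \<in> levels d k \<Longrightarrow> admissible d y"
  by (auto simp: levels_def)

lemma crossing_nonneg:
  assumes "\<And>i y. i < n \<Longrightarrow> 0 \<le> W i y" "admissible d k"
  shows "0 \<le> crossing d W n k"
  using assms
proof (induction n arbitrary: k)
  case (Suc n)
  show ?case
    unfolding crossing.simps(2)
  proof (rule cINF_greatest)
    show "levels d k \<noteq> {}" using Suc.prems by (simp add: levels_nonempty_iff)
    show "0 \<le> crossing d W n y + W n y + dist k y" if "y \<in> levels d k" for y
      using Suc.IH[of y] Suc.prems that by (simp add: levels_admissible)
  qed
qed simp

lemma crossing_bdd_below:
  assumes "\<And>i y. i \<le> n \<Longrightarrow> 0 \<le> W i y"
  shows "bdd_below ((\<lambda>y. crossing d W n y + W n y + dist k y) ` levels d k)"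
proof (rule bdd_belowI2)
  show "0 \<le> crossing d W n y + W n y + dist k y" if "y \<in> levels d k" for y
    using assms levels_admissible[OF that] crossing_nonneg[of n W d y] by simp
qed

lemma crossing_Suc_le:
  assumes "\<And>i y. i \<le> n \<Longrightarrow> 0 \<le> W i y" "y \<in> levels d k"
  shows "crossing d W (Suc n) k \<le> crossing d W n y + W n y + dist k y"
proof -
  have "bdd_below ((\<lambda>y. crossing d W n y + W n y + dist k y) ` levels d k)"
    using assms(1) by (rule crossing_bdd_below)
  from cINF_lower[OF this assms(2)] show ?thesis by (simp only: crossing.simps(2))
qed

text \<open>The infimum over infinitely many heights need not be attained, hence near-minimisers
  with slack \<open>\<eta>\<close>.\<close>

lemma crossing_Suc_approx:
  assumes "admissible d k" "0 < \<eta>"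
  obtains y where "y \<in> levels d k"
    "crossing d W n y + W n y + dist k y < crossing d W (Suc n) k + \<eta>"
proof -
  let ?F = "\<lambda>y. crossing d W n y + W n y + dist k y"
  have "?F ` levels d k \<noteq> {}" using assms(1) by (simp add: levels_nonempty_iff)
  moreover have "Inf (?F ` levels d k) < crossing d W (Suc n) k + \<eta>"
    unfolding crossing.simps(2) using assms(2) by linarith
  ultimately obtain r where "r \<in> ?F ` levels d k" "r < crossing d W (Suc n) k + \<eta>"
    by (rule cInf_lessD[elim_format]) blast
  then show ?thesis using that by (elim imageE) simp
qed

lemma crossing_cong:
  assumes "\<And>i. i < n \<Longrightarrow> W i = W' i"
  shows "crossing d W n k = crossing d W' n k"
  using assms by (induction n arbitrary: k) (auto simp: crossing.simps(2))

text \<open>Only the final vertical stretch changes: it leads from the last crossing height directly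
  to \<open>z\<close>, and the triangle inequality bounds the difference. The inclusion says that
  every last height allowed for \<open>y\<close> is allowed for \<open>z\<close>; for directed paths
  this means \<open>y \<le> z\<close>.\<close>

lemma crossing_le_vertical:
  assumes W: "\<And>i y. i < n \<Longrightarrow> 0 \<le> W i y" and "levels d y \<subseteq> levels d z" "admissible d y"
  shows "crossing d W n z \<le> crossing d W n y + dist z y"
proof (cases n)
  case (Suc m)
  show ?thesis
  proof (rule field_le_epsilon)
    fix \<eta> :: real assume "0 < \<eta>"
    then obtain w where w: "w \<in> levels d y"
      "crossing d W m w + W m w + dist y w < crossing d W (Suc m) y + \<eta>"
      using crossing_Suc_approx assms(3) by blast
    have "crossing d W (Suc m) z \<le> crossing d W m w + W m w + dist z w"
      using W assms(2) w(1) Suc by (intro crossing_Suc_le) auto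
    then show "crossing d W n z \<le> crossing d W n y + dist z y + \<eta>"
      using w(2) dist_triangle[of z w y] unfolding Suc by linarith
  qed
qed (simp add: dist_real_def)

text \<open>Let \<open>y\<close> be the height at which a near-optimal crossing for the old weights
  uses column \<open>i\<close>. With the new column, walk from \<open>y\<close> to \<open>z\<close>,
  cross there and walk back; the old nonnegative weight is dropped. The height \<open>y\<close> is
  fixed before \<open>t\<close>, which allows integration over an independent column
  \<open>t\<close>.\<close>

lemma crossing_resample_column:
  assumes "\<And>i y. i < n \<Longrightarrow> 0 \<le> W i y" "i < n" "admissible d k" "0 < \<eta>"
  shows "\<exists>y. \<forall>t. (\<forall>z. 0 \<le> t z) \<longrightarrow> (\<forall>z\<in>detours d y.
    crossing d (W(i := t)) n k \<le> crossing d W n k + \<eta> + 2 * dist z y + t z)"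
  using assms
proof (induction n arbitrary: k \<eta>)
  case (Suc n)
  show ?case
  proof (cases "i = n")
    case True
    obtain y where y: "y \<in> levels d k"
      "crossing d W n y + W n y + dist k y < crossing d W (Suc n) k + \<eta>"
      using crossing_Suc_approx Suc.prems by blast
    have "crossing d (W(i := t)) (Suc n) k \<le> crossing d W (Suc n) k + \<eta> + 2 * dist z y + t z"
      if t: "\<forall>z. 0 \<le> t z" and z: "z \<in> detours d y" for t z
    proof -
      have zl: "z \<in> levels d k" "levels d y \<subseteq> levels d z"
        using y(1) z by (auto simp: levels_def detours_def split: if_splits)
      have "crossing d (W(i := t)) (Suc n) k \<le> crossing d (W(i := t)) n z + t z + dist k z"
        using crossing_Suc_le[of n "W(i := t)" z d k] Suc.prems(1) t zl(1) True by auto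
      moreover have "crossing d (W(i := t)) n z = crossing d W n z"
        using True by (intro crossing_cong) auto
      moreover have "crossing d W n z \<le> crossing d W n y + dist z y"
        using Suc.prems(1) zl(2) y(1) by (intro crossing_le_vertical) (auto simp: levels_admissible)
      ultimately show ?thesis using y(2) Suc.prems(1)[OF lessI, of y] dist_triangle[of k z y] dist_commute[of z y] by linarith
    qed
    then show ?thesis by blast
  next
    \<comment> \<open>The last column keeps its weights, so the detour happens earlier; the slack is
      split between this column and the earlier ones.\<close>
    case False
    obtain w where w: "w \<in> levels d k"
      "crossing d W n w + W n w + dist k w < crossing d W (Suc n) k + \<eta> / 2"
      using crossing_Suc_approx[of d k "\<eta> / 2"] Suc.prems by auto
    have IH: "\<exists>y. \<forall>t. (\<forall>z. 0 \<le> t z) \<longrightarrow> (\<forall>z\<in>detours d y.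
        crossing d (W(i := t)) n w \<le> crossing d W n w + \<eta> / 2 + 2 * dist z y + t z)"
      using Suc.prems False levels_admissible[OF w(1)] by (intro Suc.IH) auto
    obtain y where y: "\<And>t z. \<forall>z. 0 \<le> t z \<Longrightarrow> z \<in> detours d y \<Longrightarrow>
        crossing d (W(i := t)) n w \<le> crossing d W n w + \<eta> / 2 + 2 * dist z y + t z"
      using IH by blast
    have "crossing d (W(i := t)) (Suc n) k \<le> crossing d W (Suc n) k + \<eta> + 2 * dist z y + t z"
      if t: "\<forall>z. 0 \<le> t z" and z: "z \<in> detours d y" for t z
    proof -
      have "crossing d (W(i := t)) (Suc n) k \<le> crossing d (W(i := t)) n w + (W(i := t)) n w + dist k w"
        using Suc.prems(1) t w(1) by (intro crossing_Suc_le) auto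
      moreover have "(W(i := t)) n w = W n w" using False by simp
      ultimately show ?thesis using y[OF t z] w(2) by linarith
    qed
    then show ?thesis by blast
  qed
qed simp

text \<open>Concatenation: the second crossing is run in the configuration translated by
  \<open>(m, j)\<close>. Induction on \<open>n\<close> attaches its columns one at a time to the
  first crossing.\<close>

lemma crossing_subadditive:
  assumes "\<And>i y. i < m + n \<Longrightarrow> 0 \<le> W i y" "admissible d j" "admissible d k"
  shows "crossing d W (m + n) (j + k) \<le> crossing d W m j + crossing d (\<lambda>i y. W (m + i) (j + y)) n k"
  using assms
proof (induction n arbitrary: k)
  case 0
  have "levels d j \<subseteq> levels d (j + k)" using 0 by (auto simp: levels_def)
  then show ?case using crossing_le_vertical[of m W d j "j + k"] 0 by (simp add: dist_real_def)
next
  case (Suc n)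
  let ?W = "\<lambda>i y. W (m + i) (j + y)"
  show ?case
  proof (rule field_le_epsilon)
    fix \<eta> :: real assume "0 < \<eta>"
    then obtain y where y: "y \<in> levels d k"
      "crossing d ?W n y + ?W n y + dist k y < crossing d ?W (Suc n) k + \<eta>"
      using crossing_Suc_approx Suc.prems by blast
    have "crossing d W (Suc (m + n)) (j + k)
        \<le> crossing d W (m + n) (j + y) + W (m + n) (j + y) + dist (j + k) (j + y)"
      using Suc.prems y(1) by (intro crossing_Suc_le) (auto simp: levels_def split: if_splits)
    moreover have "crossing d W (m + n) (j + y) \<le> crossing d W m j + crossing d ?W n y"
      using Suc.prems y(1) by (intro Suc.IH) (auto simp: levels_admissible)
    ultimately show "crossing d W (m + Suc n) (j + k) \<le> crossing d W m j + crossing d ?W (Suc n) k + \<eta>"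
      using y(2) by (simp add: dist_real_def)
  qed
qed

section \<open>Passage times as crossing times\<close>

lemma ptime_snoc:
  "ptime \<omega> (xs @ [p, q]) = ptime \<omega> (xs @ [p]) + edge_weight \<omega> p q"
proof (induction xs)
  case (Cons a xs)
  then show ?case by (cases xs) auto
qed simp

lemma is_path_snoc:
  "is_path S xs u p \<Longrightarrow> S p q \<Longrightarrow> is_path S (xs @ [q]) u q"
  by (auto simp: is_path_def successively_append_iff)

lemma ptime_append_last:
  assumes "is_path S xs u p"
  shows "ptime \<omega> (xs @ [q]) = ptime \<omega> xs + edge_weight \<omega> p q"
proof -
  have "xs = butlast xs @ [p]" using assms by (auto simp: is_path_def)
  then show ?thesis using ptime_snoc[of \<omega> "butlast xs" p q] by (metis append.assoc append_Cons append_Nil)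
qed

text \<open>Paths are built by appending sites at the end, matching the recursion of
  \<open>crossing\<close>, which splits off the last column.\<close>

lemma is_path_induct [consumes 1, case_names Nil snoc]:
  assumes "is_path S xs u w" "P [u] u"
    "\<And>xs p q. is_path S xs u p \<Longrightarrow> P xs p \<Longrightarrow> S p q \<Longrightarrow> P (xs @ [q]) q"
  shows "P xs w"
  using assms(1)
proof (induction xs arbitrary: w rule: rev_induct)
  case (snoc q xs)
  show ?case
  proof (cases "xs = []")
    case True
    then show ?thesis using snoc.prems assms(2) by (auto simp: is_path_def)
  next
    case False
    then have "is_path S xs u (last xs)" "S (last xs) q" "w = q"
      using snoc.prems by (auto simp: is_path_def successively_append_iff)
    then show ?thesis using assms(3) snoc.IH by blast
  qed
qed (simp add: is_path_def)

definition column_weights :: "(site \<Rightarrow> real) \<Rightarrow> nat \<Rightarrow> int \<Rightarrow> real" where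
  "column_weights \<omega> i y = \<omega> (int i, y)"

definition lattice_step :: "bool \<Rightarrow> site \<Rightarrow> site \<Rightarrow> bool" where
  "lattice_step d = (if d then dir_step else nn_step)"

lemma lattice_step_up: "lattice_step d (x, y) (x, y + 1)"
  and lattice_step_right: "lattice_step d (x, y) (x + 1, y)"
  and lattice_step_down: "\<not> d \<Longrightarrow> lattice_step d (x, y) (x, y - 1)"
  by (auto simp: lattice_step_def dir_step_def nn_step_def)

lemma abs_sum_eq_1:
  fixes a b :: int
  assumes "\<bar>a\<bar> + \<bar>b\<bar> = 1"
  shows "a = 1 \<and> b = 0 \<or> a = - 1 \<and> b = 0 \<or> a = 0 \<and> b = 1 \<or> a = 0 \<and> b = - 1"
proof -
  have "a = 1 \<or> a = 0 \<or> a = - 1" using assms by linarith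
  then show ?thesis using assms by (elim disjE) (auto simp: abs_if split: if_splits)
qed

text \<open>Vertical edges cost exactly 1, so an excursion to the left of the current column can be
  replaced by the vertical segment between its endpoints.\<close>

lemma crossing_le_ptime:
  assumes \<omega>: "\<And>e. 0 \<le> \<omega> e" and "is_path (lattice_step d) xs (0, 0) p"
  shows "(d \<longrightarrow> 0 \<le> fst p \<and> 0 \<le> snd p) \<and> crossing d (column_weights \<omega>) (nat (fst p)) (snd p) \<le> ptime \<omega> xs"
  using assms(2)
proof (induction rule: is_path_induct)
  case (snoc xs p q)
  obtain x y where p: "p = (x, y)" by fastforce
  have W: "0 \<le> column_weights \<omega> i z" for i z using \<omega> by (simp add: column_weights_def)
  have adm: "admissible d y" "d \<Longrightarrow> 0 \<le> x" using snoc.IH p by auto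
  have IH: "crossing d (column_weights \<omega>) (nat x) y \<le> ptime \<omega> xs" using snoc.IH p by simp
  have time: "ptime \<omega> (xs @ [q]) = ptime \<omega> xs + edge_weight \<omega> p q"
    using snoc.hyps(1) by (rule ptime_append_last)
  consider (up) "q = (x, y + 1)" | (right) "q = (x + 1, y)"
    | (down) "\<not> d" "q = (x, y - 1)" | (left) "\<not> d" "q = (x - 1, y)"
  proof (cases d)
    case True
    then show ?thesis using that snoc.hyps(2) p by (auto simp: lattice_step_def dir_step_def)
  next
    case False
    then have "\<bar>x - fst q\<bar> + \<bar>y - snd q\<bar> = 1"
      using snoc.hyps(2) p by (simp add: lattice_step_def nn_step_def)
    from abs_sum_eq_1[OF this] show ?thesis using that False by (cases q) auto
  qed
  then show ?case
  proof cases
    case up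
    have "crossing d (column_weights \<omega>) (nat x) (y + 1) \<le> crossing d (column_weights \<omega>) (nat x) y + dist (y + 1) y"
      using adm by (intro crossing_le_vertical W) (auto simp: levels_def)
    then show ?thesis using up time IH adm p by (auto simp: edge_weight_def dist_real_def)
  next
    case down
    have "crossing d (column_weights \<omega>) (nat x) (y - 1) \<le> crossing d (column_weights \<omega>) (nat x) y + dist (y - 1) y"
      using down by (intro crossing_le_vertical W) (auto simp: levels_def)
    then show ?thesis using down time IH p by (auto simp: edge_weight_def dist_real_def)
  next
    case right
    show ?thesis
    proof (cases "0 \<le> x")
      case True
      have "crossing d (column_weights \<omega>) (Suc (nat x)) y
          \<le> crossing d (column_weights \<omega>) (nat x) y + column_weights \<omega> (nat x) y + dist y y"
        using adm by (intro crossing_Suc_le W) (auto simp: levels_def)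
      moreover have "nat (x + 1) = Suc (nat x)" using True by simp
      ultimately show ?thesis
        using right time IH adm p True by (auto simp: edge_weight_def column_weights_def[of _ "nat x"])
    next
      \<comment> \<open>To the left of the origin \<open>nat\<close> gives 0, so a step to the right
        keeps the column count and only adds a nonnegative weight.\<close>
      case False
      then have "nat (x + 1) = nat x" by simp
      then show ?thesis using right time IH adm p False \<omega>[of "(x, y)"] by (auto simp: edge_weight_def dist_real_def)
    qed
  next
    case left
    \<comment> \<open>A left step undoes a column: every candidate for the infimum at abscissa
      \<open>x\<close> passes through some height \<open>z\<close> at abscissa \<open>x - 1\<close>,
      from which \<open>y\<close> is reached vertically without paying the last weight.\<close>
    have "crossing d (column_weights \<omega>) (nat (x - 1)) y \<le> crossing d (column_weights \<omega>) (nat x) y"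
    proof (cases "0 < x")
      case True
      then have x: "nat x = Suc (nat (x - 1))" by simp
      have "crossing d (column_weights \<omega>) (nat (x - 1)) y
          \<le> crossing d (column_weights \<omega>) (nat (x - 1)) z + column_weights \<omega> (nat (x - 1)) z + dist y z" for z
        using crossing_le_vertical[of "nat (x - 1)" "column_weights \<omega>" d z y, OF W] W[of "nat (x - 1)" z] left
        by (simp add: levels_def)
      then show ?thesis unfolding x crossing.simps(2) using left
        by (intro cINF_greatest) (auto simp: levels_def)
    next
      case False
      then have "nat (x - 1) = nat x" by simp
      then show ?thesis by simp
    qed
    then show ?thesis using left time IH p \<omega>[of "(x - 1, y)"] by (auto simp: edge_weight_def dist_real_def)
  qed
qed simp

lemma vertical_extension:
  assumes "is_path (lattice_step d) xs (0, 0) (x, y)" "y \<in> levels d z"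
  shows "\<exists>ys. is_path (lattice_step d) ys (0, 0) (x, z) \<and> ptime \<omega> ys = ptime \<omega> xs + dist z y"
proof -
  have up: "\<exists>ys. is_path (lattice_step d) ys (0, 0) (x, y + int m) \<and> ptime \<omega> ys = ptime \<omega> xs + real m" for m
  proof (induction m)
    case (Suc m)
    then obtain ys where ys: "is_path (lattice_step d) ys (0, 0) (x, y + int m)" "ptime \<omega> ys = ptime \<omega> xs + real m"
      by blast
    show ?case
      using is_path_snoc[OF ys(1) lattice_step_up] ptime_append_last[OF ys(1), of \<omega> "(x, y + int m + 1)"] ys(2)
      by (intro exI[of _ "ys @ [(x, y + int m + 1)]"]) (auto simp: edge_weight_def add_ac)
  qed (use assms in auto)
  have down: "\<exists>ys. is_path (lattice_step d) ys (0, 0) (x, y - int m) \<and> ptime \<omega> ys = ptime \<omega> xs + real m"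
    if "\<not> d" for m
  proof (induction m)
    case (Suc m)
    then obtain ys where ys: "is_path (lattice_step d) ys (0, 0) (x, y - int m)" "ptime \<omega> ys = ptime \<omega> xs + real m"
      by blast
    show ?case
      using is_path_snoc[OF ys(1) lattice_step_down[OF that]] ptime_append_last[OF ys(1), of \<omega> "(x, y - int m - 1)"] ys(2)
      by (intro exI[of _ "ys @ [(x, y - int m - 1)]"]) (auto simp: edge_weight_def algebra_simps)
  qed (use assms in auto)
  show ?thesis
  proof (cases "y \<le> z")
    case True
    then show ?thesis using up[of "nat (z - y)"] by (simp add: dist_real_def)
  next
    case False
    moreover have "\<not> d" using False assms(2) by (auto simp: levels_def)
    ultimately show ?thesis using down[of "nat (y - z)"] by (simp add: dist_real_def)
  qed
qed

text \<open>Converse to \<open>crossing_le_ptime\<close>: near-minimising heights, chosen from the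
  last column backwards, are joined to an actual lattice path. Half the slack goes to the last
  column and half to the earlier ones.\<close>

lemma path_near_crossing:
  assumes "admissible d k" "0 < \<eta>"
  shows "\<exists>xs. is_path (lattice_step d) xs (0, 0) (int n, k) \<and> ptime \<omega> xs \<le> crossing d (column_weights \<omega>) n k + \<eta>"
  using assms
proof (induction n arbitrary: k \<eta>)
  case 0
  have "is_path (lattice_step d) [(0, 0)] (0, 0) (0, 0)" by (simp add: is_path_def)
  moreover have "0 \<in> levels d k" using 0 by (auto simp: levels_def)
  ultimately show ?case using vertical_extension[of d "[(0, 0)]" 0 0 k \<omega>] 0 by fastforce
next
  case (Suc n)
  let ?V = "crossing d (column_weights \<omega>)"
  obtain y where y: "y \<in> levels d k"
    "?V n y + column_weights \<omega> n y + dist k y < ?V (Suc n) k + \<eta> / 2"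
    using crossing_Suc_approx[of d k "\<eta> / 2"] Suc.prems by auto
  obtain xs where xs: "is_path (lattice_step d) xs (0, 0) (int n, y)" "ptime \<omega> xs \<le> ?V n y + \<eta> / 2"
    using Suc.IH[of y "\<eta> / 2"] y(1) Suc.prems by (auto simp: levels_admissible)
  have step: "is_path (lattice_step d) (xs @ [(int n + 1, y)]) (0, 0) (int (Suc n), y)"
    using is_path_snoc[OF xs(1) lattice_step_right] by (simp add: add.commute)
  obtain ys where ys: "is_path (lattice_step d) ys (0, 0) (int (Suc n), k)"
    "ptime \<omega> ys = ptime \<omega> (xs @ [(int n + 1, y)]) + dist k y"
    using vertical_extension[OF step y(1)] by blast
  have "ptime \<omega> (xs @ [(int n + 1, y)]) = ptime \<omega> xs + column_weights \<omega> n y"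
    using ptime_append_last[OF xs(1)] by (simp add: edge_weight_def column_weights_def)
  then show ?case using ys y(2) xs(2) by (intro exI[of _ ys]) linarith
qed

lemma Inf_ptime_eq_crossing:
  assumes \<omega>: "\<And>e. 0 \<le> \<omega> e" and k: "admissible d k"
  shows "Inf (ptime \<omega> ` {xs. is_path (lattice_step d) xs (0, 0) (int n, k)}) = crossing d (column_weights \<omega>) n k"
    (is "Inf ?S = ?c")
proof (rule antisym)
  have lower: "?c \<le> t" if "t \<in> ?S" for t
    using crossing_le_ptime[OF \<omega>] that by fastforce
  show "Inf ?S \<le> ?c"
  proof (rule field_le_epsilon)
    fix \<eta> :: real assume "0 < \<eta>"
    then obtain xs where "is_path (lattice_step d) xs (0, 0) (int n, k)" "ptime \<omega> xs \<le> ?c + \<eta>"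
      using path_near_crossing k by blast
    moreover have "Inf ?S \<le> ptime \<omega> xs"
      using lower calculation(1) by (intro cInf_lower bdd_belowI[of _ ?c]) auto
    ultimately show "Inf ?S \<le> ?c + \<eta>" by simp
  qed
  have "?S \<noteq> {}" using path_near_crossing[OF k, of 1 n \<omega>] by auto
  then show "?c \<le> Inf ?S" using lower by (intro cInf_greatest)
qed

lemma passage_eq_crossing:
  assumes "\<And>e. 0 \<le> \<omega> e"
  shows "passage \<omega> (0, 0) (int n, k) = crossing False (column_weights \<omega>) n k"
  using Inf_ptime_eq_crossing[of \<omega> False k n] assms by (simp add: passage_def lattice_step_def)

lemma passage_dir_eq_crossing:
  assumes "\<And>e. 0 \<le> \<omega> e" "0 \<le> k"
  shows "passage_dir \<omega> (0, 0) (int n, k) = crossing True (column_weights \<omega>) n k"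
  using Inf_ptime_eq_crossing[of \<omega> True k n] assms by (simp add: passage_dir_def lattice_step_def)

section \<open>Independence of the columns\<close>

text \<open>The law lives on the subspace \<open>{0..}\<close> rather than on the whole line, so
  configurations are nonnegative at every point of the space, not only almost surely.\<close>

locale weight_law =
  fixes G :: "real measure"
  assumes prob_space_G: "prob_space G"
    and sets_G: "sets G = sets (restrict_space borel {0::real..})"
begin

abbreviation column_law :: "(int \<Rightarrow> real) measure" where
  "column_law \<equiv> Pi\<^sub>M UNIV (\<lambda>_. G)"

text \<open>Weights are grouped by column: one coordinate of this product is a whole column, so
  resampling a coordinate resamples a column.\<close>

abbreviation strip_law :: "nat \<Rightarrow> (nat \<Rightarrow> int \<Rightarrow> real) measure" where
  "strip_law n \<equiv> Pi\<^sub>M {..<n} (\<lambda>_. column_law)"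

lemma space_G: "space G = {0..}"
  using sets_eq_imp_space_eq[OF sets_G] by (simp add: space_restrict_space)

lemma measurable_id_G [measurable]: "(\<lambda>x. x) \<in> borel_measurable G"
  unfolding measurable_cong_sets[OF sets_G refl] by (rule measurable_restrict_space1) simp

lemma prob_space_config: "prob_space (config G)"
  and prob_space_column_law: "prob_space column_law"
  and prob_space_strip_law: "prob_space (strip_law n)"
  unfolding config_def by (intro prob_space_PiM prob_space_G)+

lemma config_nonneg: "\<omega> \<in> space (config G) \<Longrightarrow> 0 \<le> \<omega> e"
  using space_G by (auto simp: config_def space_PiM)

lemma column_nonneg: "t \<in> space column_law \<Longrightarrow> 0 \<le> t y"
  using space_G by (auto simp: space_PiM)

lemma strip_nonneg: "x \<in> space (strip_law n) \<Longrightarrow> i < n \<Longrightarrow> 0 \<le> x i y"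
  using space_G by (auto simp: space_PiM)

lemma measurable_column [measurable]: "(\<lambda>t. t y) \<in> borel_measurable column_law"
  by (rule measurable_compose[where f = "\<lambda>t. t y", OF measurable_component_singleton measurable_id_G]) simp

lemma measurable_config [measurable]: "(\<lambda>\<omega>. \<omega> e) \<in> borel_measurable (config G)"
  unfolding config_def
  by (rule measurable_compose[where f = "\<lambda>\<omega>. \<omega> e", OF measurable_component_singleton measurable_id_G]) simp

lemma measurable_strip: "i < n \<Longrightarrow> (\<lambda>x. x i y) \<in> borel_measurable (strip_law n)"
  by (rule measurable_compose[where f = "\<lambda>x. x i", OF measurable_component_singleton measurable_column]) simp

text \<open>The heights form a countable set, so the infimum preserves measurability.\<close>

lemma crossing_measurable_strip:
  assumes "n \<le> m"
  shows "(\<lambda>x. crossing d x n k) \<in> borel_measurable (strip_law m)"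
  using assms
proof (induction n arbitrary: k)
  case (Suc n)
  have "(\<lambda>x. crossing d x n y + x n y + dist k y) \<in> borel_measurable (strip_law m)" for y
    using Suc by (intro borel_measurable_add measurable_strip Suc.IH) auto
  then show ?case
    unfolding crossing.simps(2) by (intro borel_measurable_cINF_real) auto
qed simp

lemma crossing_measurable [measurable]:
  "(\<lambda>\<omega>. crossing d (column_weights \<omega>) n k) \<in> borel_measurable (config G)"
proof (induction n arbitrary: k)
  case (Suc n)
  have "(\<lambda>\<omega>. crossing d (column_weights \<omega>) n y + column_weights \<omega> n y + dist k y) \<in> borel_measurable (config G)" for y
    unfolding column_weights_def[of _ n] by (intro borel_measurable_add Suc.IH) auto
  then show ?case
    unfolding crossing.simps(2) by (intro borel_measurable_cINF_real) auto
qed simp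

lemma distr_column: "distr (config G) column_law (\<lambda>\<omega>. column_weights \<omega> i) = column_law"
  using distr_PiM_reindex[of UNIV "\<lambda>_. G" "\<lambda>y. (int i, y)" UNIV] prob_space_G
  by (simp add: config_def column_weights_def[abs_def] inj_on_def restrict_UNIV)

lemma distr_shift:
  "distr (config G) (config G) (\<lambda>\<omega> e. \<omega> (fst e + a, snd e + b)) = config G"
  using distr_PiM_reindex[of UNIV "\<lambda>_. G" "\<lambda>e. (fst e + a, snd e + b)" UNIV] prob_space_G
  by (simp add: config_def inj_on_def prod_eq_iff restrict_UNIV)

lemma measurable_shift: "(\<lambda>\<omega> e. \<omega> (fst e + a, snd e + b)) \<in> measurable (config G) (config G)"
  unfolding config_def by (rule measurable_PiM_single') (auto simp: space_PiM)

lemma measurable_strip_weights: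
  "(\<lambda>\<omega>. \<lambda>i\<in>{..<n}. column_weights \<omega> i) \<in> measurable (config G) (strip_law n)"
  unfolding column_weights_def[abs_def] config_def
  by (intro measurable_restrict measurable_PiM_single') (auto simp: space_PiM)

text \<open>Different columns use disjoint sets of edges and are therefore independent, each with
  law \<open>column_law\<close>. This carries the product bounds over to
  \<open>config G\<close>.\<close>

lemma distr_strip:
  "distr (config G) (strip_law n) (\<lambda>\<omega>. \<lambda>i\<in>{..<n}. column_weights \<omega> i) = strip_law n"
proof (cases "n = 0")
  \<comment> \<open>The empty product is a one-point space, on which any two probability measures
    agree.\<close>
  case True
  let ?D = "distr (config G) (strip_law n) (\<lambda>\<omega>. \<lambda>i\<in>{..<n}. column_weights \<omega> i)"
  interpret D: prob_space ?D
    by (rule prob_space.prob_space_distr[OF prob_space_config measurable_strip_weights])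
  interpret S: prob_space "strip_law n" by (rule prob_space_strip_law)
  show ?thesis
  proof (rule measure_eqI)
    fix A assume "A \<in> sets ?D"
    then have "A = {} \<or> A = space (strip_law n)" using True by (auto simp: PiM_empty)
    then show "emeasure ?D A = emeasure (strip_law n) A"
      using D.emeasure_space_1 S.emeasure_space_1 by auto
  qed simp
next
  case False
  interpret prob_space "config G" by (rule prob_space_config)
  have "distr (config G) G (\<lambda>\<omega>. \<omega> e) = G" for e
    using distr_PiM_component[of UNIV "\<lambda>_. G" e] prob_space_G by (simp add: config_def)
  then have "indep_vars (\<lambda>_. G) (\<lambda>e \<omega>. \<omega> e) (UNIV :: site set)"
    by (subst indep_vars_iff_distr_eq_PiM) (simp_all add: config_def restrict_UNIV distr_id)
  then have "indep_vars (\<lambda>i. Pi\<^sub>M ({int i} \<times> UNIV) (\<lambda>_. G)) (\<lambda>i \<omega>. restrict \<omega> ({int i} \<times> UNIV)) {..<n}"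
    by (rule indep_vars_restrict) (auto simp: disjoint_family_on_def)
  then have "indep_vars (\<lambda>_. column_law) (\<lambda>i \<omega>. (\<lambda>r y. r (int i, y)) (restrict \<omega> ({int i} \<times> UNIV))) {..<n}"
    by (rule indep_vars_compose2) (rule measurable_PiM_single', auto simp: space_PiM PiE_iff)
  then have ind: "indep_vars (\<lambda>_. column_law) (\<lambda>i \<omega>. column_weights \<omega> i) {..<n}"
    by (simp add: column_weights_def[abs_def])
  have rv: "(\<lambda>\<omega>. column_weights \<omega> i) \<in> measurable (config G) column_law" for i
    unfolding column_weights_def[abs_def] config_def
    by (rule measurable_PiM_single') (auto simp: space_PiM)
  show ?thesis
    using ind False by (subst (asm) indep_vars_iff_distr_eq_PiM[OF _ rv]) (auto simp: distr_column)
qed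

lemma crossing_restrict: "crossing d (\<lambda>i\<in>{..<n}. W i) n k = crossing d W n k"
  by (rule crossing_cong) simp

lemma nn_integral_strip:
  assumes "h \<in> borel_measurable (strip_law n)"
  shows "(\<integral>\<^sup>+x. h x \<partial>strip_law n) = (\<integral>\<^sup>+\<omega>. h (\<lambda>i\<in>{..<n}. column_weights \<omega> i) \<partial>config G)"
  using nn_integral_distr[OF measurable_strip_weights] assms by (simp add: distr_strip)

lemma integral_strip:
  fixes h :: "(nat \<Rightarrow> int \<Rightarrow> real) \<Rightarrow> real"
  assumes "h \<in> borel_measurable (strip_law n)"
  shows "(\<integral>x. h x \<partial>strip_law n) = (\<integral>\<omega>. h (\<lambda>i\<in>{..<n}. column_weights \<omega> i) \<partial>config G)"
  using integral_distr[OF measurable_strip_weights assms] by (simp add: distr_strip)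

end

section \<open>Mean crossing times\<close>

text \<open>Fekete's lemma for \<open>u n + C\<close>, which is exactly subadditive: the limit is
  the infimum of \<open>(u n + C) / real n\<close> over \<open>n \<ge> 1\<close>, and this yields
  the lower bound at every \<open>n\<close>.\<close>

lemma approx_subadditive_limit:
  fixes u :: "nat \<Rightarrow> real"
  assumes nonneg: "\<And>n. 0 \<le> u n" and C: "0 \<le> C"
    and sub: "\<And>m n. u (m + n) \<le> u m + u n + C"
  obtains c where "(\<lambda>n. u n / real n) \<longlonglongrightarrow> c" "\<And>n. real n * c \<le> u n + C"
proof
  define w where "w n = u n + C" for n
  have w0: "0 \<le> w n" for n using nonneg C by (simp add: w_def)
  have wsub: "w (m + n) \<le> w m + w n" for m n using sub[of m n] by (simp add: w_def)
  define S where "S = (\<lambda>n. w n / real n) ` {1..}"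
  define c where "c = Inf S"
  have bdd: "bdd_below S" unfolding S_def using w0 by (intro bdd_belowI2[where m = 0]) auto
  have le: "c \<le> w n / real n" if "1 \<le> n" for n
    unfolding c_def using bdd that by (intro cInf_lower) (auto simp: S_def)
  show lower: "real n * c \<le> u n + C" for n
  proof (cases "n = 0")
    case False
    then show ?thesis using le[of n] by (simp add: w_def field_simps)
  qed (use w0 in \<open>simp add: w_def\<close>)
  have mult: "w (q * m + r) \<le> real q * w m + w r" for q m r
  proof (induction q)
    case (Suc q)
    have "w (Suc q * m + r) \<le> w m + w (q * m + r)" using wsub[of m "q * m + r"] by (simp add: add.assoc)
    then show ?case using Suc by (simp add: algebra_simps)
  qed simp
  show "(\<lambda>n. u n / real n) \<longlonglongrightarrow> c"
  proof (rule LIMSEQ_I)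
    fix \<epsilon> :: real assume \<epsilon>: "0 < \<epsilon>"
    obtain m where m: "1 \<le> m" "w m / real m < c + \<epsilon> / 2"
    proof -
      have "S \<noteq> {}" by (auto simp: S_def)
      moreover have "Inf S < c + \<epsilon> / 2" using \<epsilon> by (simp add: c_def)
      ultimately show ?thesis using cInf_lessD[of S "c + \<epsilon> / 2"] that by (auto simp: S_def)
    qed
    \<comment> \<open>\<open>K\<close> bounds \<open>w\<close> at every remainder modulo
      \<open>m\<close>.\<close>
    define K where "K = (\<Sum>r<m. w r)"
    have K: "w r \<le> K" if "r < m" for r
      unfolding K_def using that w0 by (intro member_le_sum) auto
    have K0: "0 \<le> K" unfolding K_def using w0 by (simp add: sum_nonneg)
    \<comment> \<open>Beyond \<open>n0\<close> the remainder and the shift by \<open>C\<close>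
      together cost less than \<open>\<epsilon> / 2\<close>.\<close>
    obtain n0 :: nat where n0: "2 * (K + C + 1) / \<epsilon> < real n0" using reals_Archimedean2 by blast
    have "norm (u n / real n - c) < \<epsilon>" if n: "n0 \<le> n" for n
    proof -
      have n1: "2 * (K + C + 1) / \<epsilon> < real n" using n0 n by linarith
      have "0 \<le> 2 * (K + C + 1) / \<epsilon>" using K0 C \<epsilon> by simp
      then have pos: "0 < real n" using n1 by linarith
      have KC: "(K + C + 1) / real n < \<epsilon> / 2" using n1 pos \<epsilon> by (simp add: field_simps)
      have "w n \<le> real (n div m) * w m + w (n mod m)" using mult[of "n div m" m "n mod m"] by simp
      also have "\<dots> \<le> (real n / real m) * w m + K"
      proof (intro add_mono mult_right_mono w0 K)
        have "real (n div m) * real m \<le> real n"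
          by (metis div_times_less_eq_dividend of_nat_le_iff of_nat_mult)
        then show "real (n div m) \<le> real n / real m" using m(1) by (simp add: field_simps)
        show "n mod m < m" using m(1) by simp
      qed
      finally have "w n / real n \<le> ((real n / real m) * w m + K) / real n"
        using pos by (intro divide_right_mono) auto
      also have "\<dots> = w m / real m + K / real n" using pos m(1) by (simp add: field_simps)
      finally have "u n / real n + C / real n \<le> w m / real m + K / real n"
        by (simp add: w_def add_divide_distrib)
      moreover have "c \<le> u n / real n + C / real n"
        using lower[of n] pos by (simp add: field_simps)
      moreover have "0 \<le> C / real n" "0 \<le> K / real n" "0 < 1 / real n" using C K0 pos by auto
      moreover have "K / real n + C / real n + 1 / real n < \<epsilon> / 2"
        using KC by (simp add: add_divide_distrib)
      ultimately have "\<bar>u n / real n - c\<bar> < \<epsilon>" using m(2) by linarith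
      then show ?thesis by simp
    qed
    then show "\<exists>n0. \<forall>n\<ge>n0. norm (u n / real n - c) < \<epsilon>" by blast
  qed
qed

text \<open>The hypothesis says that the cheapest way of crossing a fresh column near height \<open>y\<close>
  has an exponential moment that does not depend on \<open>y\<close>.\<close>

locale light_crossings = weight_law +
  fixes d :: bool and s \<kappa> :: real
  assumes s_pos: "0 < s" and \<kappa>_nonneg: "0 \<le> \<kappa>"
    and cheap_crossing: "\<exists>E \<in> borel_measurable (Pi\<^sub>M UNIV (\<lambda>_. G)).
      (\<integral>\<^sup>+t. E t \<partial>Pi\<^sub>M UNIV (\<lambda>_. G)) \<le> ennreal \<kappa> \<and>
      (\<forall>t \<in> space (Pi\<^sub>M UNIV (\<lambda>_. G)). \<forall>r. (\<forall>z\<in>detours d y. r \<le> 2 * dist z y + t z)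
          \<longrightarrow> ennreal (exp (s * r)) \<le> E t)"
begin

abbreviation crossing_time :: "(site \<Rightarrow> real) \<Rightarrow> nat \<Rightarrow> int \<Rightarrow> real" where
  "crossing_time \<omega> n k \<equiv> crossing d (column_weights \<omega>) n k"

abbreviation mean_time :: "nat \<Rightarrow> int \<Rightarrow> real" where
  "mean_time n k \<equiv> (\<integral>\<omega>. crossing_time \<omega> n k \<partial>config G)"

lemma weights_nonneg: "\<omega> \<in> space (config G) \<Longrightarrow> 0 \<le> column_weights \<omega> i y"
  by (simp add: column_weights_def config_nonneg)

lemma crossing_time_nonneg:
  "\<omega> \<in> space (config G) \<Longrightarrow> admissible d k \<Longrightarrow> 0 \<le> crossing_time \<omega> n k"
  by (intro crossing_nonneg weights_nonneg)

lemma integrable_shift: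
  fixes h :: "(site \<Rightarrow> real) \<Rightarrow> real"
  assumes "integrable (config G) h"
  shows "integrable (config G) (\<lambda>\<omega>. h (\<lambda>e. \<omega> (fst e + a, snd e + b)))"
  using assms integrable_distr_eq[OF measurable_shift, of h a b]
  by (simp add: distr_shift borel_measurable_integrable)

lemma integral_shift:
  fixes h :: "(site \<Rightarrow> real) \<Rightarrow> real"
  assumes "integrable (config G) h"
  shows "(\<integral>\<omega>. h (\<lambda>e. \<omega> (fst e + a, snd e + b)) \<partial>config G) = (\<integral>\<omega>. h \<omega> \<partial>config G)"
  using assms integral_distr[OF measurable_shift, of h a b]
  by (simp add: distr_shift borel_measurable_integrable)

lemma crossing_time_subadditive:
  assumes "\<omega> \<in> space (config G)" "admissible d j" "admissible d k"
  shows "crossing_time \<omega> (m + n) (j + k)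
    \<le> crossing_time \<omega> m j + crossing_time (\<lambda>e. \<omega> (fst e + int m, snd e + j)) n k"
proof -
  have "column_weights (\<lambda>e. \<omega> (fst e + int m, snd e + j)) = (\<lambda>i y. column_weights \<omega> (m + i) (j + y))"
    by (simp add: column_weights_def fun_eq_iff add.commute)
  then show ?thesis using crossing_subadditive[of m n "column_weights \<omega>" d j k] assms weights_nonneg by simp
qed

text \<open>The cost of a single column, ending at height 0, is dominated through \<open>E\<close>.
  More columns follow from subadditivity and translation invariance: the first column is crossed to
  height 0, and the induction hypothesis covers the remaining \<open>n\<close> columns up to
  \<open>k\<close>.\<close>

lemma integrable_crossing_time:
  assumes "admissible d k"
  shows "integrable (config G) (\<lambda>\<omega>. crossing_time \<omega> n k)"
proof (induction n)
  interpret prob_space "config G" by (rule prob_space_config)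
  {
    case 0
    show ?case by simp
  next
    case (Suc n)
    obtain E where E [measurable]: "E \<in> borel_measurable column_law"
      and E_le: "(\<integral>\<^sup>+t. E t \<partial>column_law) \<le> ennreal \<kappa>"
      and E_ge: "\<forall>t \<in> space column_law. \<forall>r. (\<forall>z\<in>detours d 0. r \<le> 2 * dist z (real_of_int 0) + t z)
        \<longrightarrow> ennreal (exp (s * r)) \<le> E t"
      using cheap_crossing[of 0] by (elim bexE conjE) (rule that; assumption)
    have rv: "(\<lambda>\<omega>. column_weights \<omega> 0) \<in> measurable (config G) column_law"
      unfolding column_weights_def[abs_def] config_def
      by (rule measurable_PiM_single') (auto simp: space_PiM)
    have "ennreal (s * crossing_time \<omega> 1 0) \<le> E (column_weights \<omega> 0)" if \<omega>: "\<omega> \<in> space (config G)" for \<omega>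
    proof -
      have "crossing_time \<omega> 1 0 \<le> 2 * dist z 0 + column_weights \<omega> 0 z" if "z \<in> detours d 0" for z
        using crossing_Suc_le[of 0 "column_weights \<omega>" z d 0] weights_nonneg[OF \<omega>] that
        by (auto simp: levels_def detours_def dist_real_def split: if_splits)
      then have "ennreal (exp (s * crossing_time \<omega> 1 0)) \<le> E (column_weights \<omega> 0)"
        using E_ge measurable_space[OF rv \<omega>] by simp
      moreover have "s * crossing_time \<omega> 1 0 \<le> exp (s * crossing_time \<omega> 1 0)"
        using exp_ge_add_one_self[of "s * crossing_time \<omega> 1 0"] by linarith
      ultimately show ?thesis by (meson ennreal_leI order_trans)
    qed
    then have "(\<integral>\<^sup>+\<omega>. ennreal (s * crossing_time \<omega> 1 0) \<partial>config G) \<le> (\<integral>\<^sup>+\<omega>. E (column_weights \<omega> 0) \<partial>config G)"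
      by (rule nn_integral_mono)
    also have "\<dots> = (\<integral>\<^sup>+t. E t \<partial>column_law)"
      using nn_integral_distr[OF rv, of E] E by (simp add: distr_column)
    also have "\<dots> < \<infinity>" using E_le by (simp add: le_less_trans)
    finally have "integrable (config G) (\<lambda>\<omega>. s * crossing_time \<omega> 1 0)"
      using crossing_time_nonneg s_pos by (intro integrableI_nonneg) auto
    then have one: "integrable (config G) (\<lambda>\<omega>. crossing_time \<omega> 1 0)"
      using s_pos by simp
    have "integrable (config G) (\<lambda>\<omega>. crossing_time \<omega> 1 0 + crossing_time (\<lambda>e. \<omega> (fst e + int 1, snd e + 0)) n k)"
      by (intro Bochner_Integration.integrable_add one integrable_shift Suc.IH)
    then show ?case
    proof (rule Bochner_Integration.integrable_bound)
      show "AE \<omega> in config G. norm (crossing_time \<omega> (Suc n) k)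
          \<le> norm (crossing_time \<omega> 1 0 + crossing_time (\<lambda>e. \<omega> (fst e + int 1, snd e + 0)) n k)"
      proof (rule AE_I2)
        fix \<omega> assume \<omega>: "\<omega> \<in> space (config G)"
        then show "norm (crossing_time \<omega> (Suc n) k)
          \<le> norm (crossing_time \<omega> 1 0 + crossing_time (\<lambda>e. \<omega> (fst e + int 1, snd e + 0)) n k)"
          using crossing_time_subadditive[OF \<omega>, of 0 k 1 n] assms crossing_time_nonneg[OF \<omega>, of k "Suc n"] by simp
      qed
    qed measurable
  }
qed

lemma mean_time_subadditive:
  assumes k: "admissible d j" "admissible d k"
  shows "mean_time (m + n) (j + k) \<le> mean_time m j + mean_time n k"
proof -
  have int: "integrable (config G) (\<lambda>\<omega>. crossing_time \<omega> m j)"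
    "integrable (config G) (\<lambda>\<omega>. crossing_time (\<lambda>e. \<omega> (fst e + int m, snd e + j)) n k)"
    by (intro integrable_shift[of "\<lambda>\<omega>. crossing_time \<omega> n k"] integrable_crossing_time k)+
  have "mean_time (m + n) (j + k)
      \<le> (\<integral>\<omega>. crossing_time \<omega> m j + crossing_time (\<lambda>e. \<omega> (fst e + int m, snd e + j)) n k \<partial>config G)"
    using int by (intro integral_mono crossing_time_subadditive integrable_crossing_time
        Bochner_Integration.integrable_add) (use k in auto)
  also have "\<dots> = mean_time m j + mean_time n k"
    using int integral_shift[OF integrable_crossing_time[OF k(2), of n], of "int m" j] by simp
  finally show ?thesis .
qed

lemma mean_time_vertical:
  assumes "levels d y \<subseteq> levels d z" "admissible d y" "admissible d z"
  shows "mean_time n z \<le> mean_time n y + dist z y"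
proof -
  interpret prob_space "config G" by (rule prob_space_config)
  have "mean_time n z \<le> (\<integral>\<omega>. crossing_time \<omega> n y + dist z y \<partial>config G)"
    using assms by (intro integral_mono crossing_le_vertical integrable_crossing_time
        Bochner_Integration.integrable_add[OF _ integrable_const] weights_nonneg)
  also have "\<dots> = mean_time n y + dist z y"
    using assms integrable_crossing_time[of y n] by (simp add: prob_space)
  finally show ?thesis .
qed

text \<open>Near-optimality with slack 1 produces the factor \<open>exp s\<close>. Truncation cannot
  enlarge an increase, and the detour cost is nonnegative, so the bound of
  \<open>crossing_resample_column\<close> survives under \<open>min b\<close>.\<close>

lemma truncated_crossing_resample:
  assumes x: "x \<in> space (strip_law n)" and "i < n" and k: "admissible d k"
  shows "(\<integral>\<^sup>+t. ennreal (exp (s * (min b (crossing d (x(i := t)) n k) - min b (crossing d x n k)))) \<partial>column_law)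
    \<le> ennreal (exp s * \<kappa>)"
proof -
  have "\<exists>y. \<forall>t. (\<forall>z. 0 \<le> t z) \<longrightarrow> (\<forall>z\<in>detours d y.
    crossing d (x(i := t)) n k \<le> crossing d x n k + 1 + 2 * dist z y + t z)"
    using assms strip_nonneg[OF x] by (intro crossing_resample_column) auto
  then obtain y where y: "\<And>t z. (\<forall>z. 0 \<le> t z) \<Longrightarrow> z \<in> detours d y \<Longrightarrow>
    crossing d (x(i := t)) n k \<le> crossing d x n k + 1 + 2 * dist z y + t z"
    by blast
  obtain E where E [measurable]: "E \<in> borel_measurable column_law"
    and E_le: "(\<integral>\<^sup>+t. E t \<partial>column_law) \<le> ennreal \<kappa>"
    and E_ge: "\<forall>t \<in> space column_law. \<forall>r. (\<forall>z\<in>detours d y. r \<le> 2 * dist z (real_of_int y) + t z)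
        \<longrightarrow> ennreal (exp (s * r)) \<le> E t"
    using cheap_crossing[of y] by (elim bexE conjE) (rule that; assumption)
  have "(\<integral>\<^sup>+t. ennreal (exp (s * (min b (crossing d (x(i := t)) n k) - min b (crossing d x n k)))) \<partial>column_law)
      \<le> (\<integral>\<^sup>+t. ennreal (exp s) * E t \<partial>column_law)"
  proof (rule nn_integral_mono)
    fix t assume t: "t \<in> space column_law"
    let ?r = "min b (crossing d (x(i := t)) n k) - min b (crossing d x n k) - 1"
    have "?r \<le> 2 * dist z y + t z" if "z \<in> detours d y" for z
    proof -
      have "0 \<le> t z" "0 \<le> dist z y" using column_nonneg[OF t] by auto
      moreover have "crossing d (x(i := t)) n k \<le> crossing d x n k + 1 + 2 * dist z y + t z"
        using column_nonneg[OF t] that by (intro y) auto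
      ultimately show ?thesis by linarith
    qed
    then have "ennreal (exp (s * ?r)) \<le> E t" using E_ge t by blast
    then have "ennreal (exp s) * ennreal (exp (s * ?r)) \<le> ennreal (exp s) * E t" by (intro mult_left_mono) auto
    also have "ennreal (exp s) * ennreal (exp (s * ?r)) = ennreal (exp (s * (?r + 1)))"
      by (simp add: ennreal_mult[symmetric] exp_add[symmetric] algebra_simps)
    finally show "ennreal (exp (s * (min b (crossing d (x(i := t)) n k) - min b (crossing d x n k)))) \<le> ennreal (exp s) * E t"
      by simp
  qed
  also have "\<dots> = ennreal (exp s) * (\<integral>\<^sup>+t. E t \<partial>column_law)"
    by (rule nn_integral_cmult) measurable
  also have "\<dots> \<le> ennreal (exp s) * ennreal \<kappa>"
    by (intro mult_left_mono E_le) auto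
  finally show ?thesis using \<kappa>_nonneg by (simp add: ennreal_mult)
qed

text \<open>The product bound for the truncated crossing time as a function of \<open>n\<close>
  columns, followed by \<open>1 + x \<le> exp x\<close>. The result depends on neither
  \<open>b\<close> nor \<open>k\<close>.\<close>

lemma truncated_mgf:
  assumes k: "admissible d k" and b: "0 \<le> b" and l: "\<bar>l\<bar> \<le> s"
  shows "(\<integral>\<^sup>+\<omega>. ennreal (exp (l * (min b (crossing_time \<omega> n k) - (\<integral>\<omega>. min b (crossing_time \<omega> n k) \<partial>config G)))) \<partial>config G)
    \<le> ennreal (exp (real n * ((l / s)\<^sup>2 * (exp s * \<kappa>))))"
proof -
  let ?f = "\<lambda>x. min b (crossing d x n k)" and ?K = "(l / s)\<^sup>2 * (exp s * \<kappa>)"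
  have K0: "0 \<le> ?K" using \<kappa>_nonneg by simp
  note [measurable] = crossing_measurable_strip[OF order_refl, of d n k]
  have E: "(\<integral>x. ?f x \<partial>strip_law n) = (\<integral>\<omega>. min b (crossing_time \<omega> n k) \<partial>config G)"
    by (subst integral_strip) (measurable, simp add: crossing_restrict)
  have "(\<integral>\<^sup>+\<omega>. ennreal (exp (l * (min b (crossing_time \<omega> n k) - (\<integral>\<omega>. min b (crossing_time \<omega> n k) \<partial>config G)))) \<partial>config G)
      = (\<integral>\<^sup>+x. ennreal (exp (l * (?f x - (\<integral>x. ?f x \<partial>strip_law n)))) \<partial>strip_law n)"
    unfolding E by (subst nn_integral_strip) (measurable, simp add: crossing_restrict)
  also have "\<dots> \<le> ennreal ((1 + ?K) ^ card {..<n})"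
  proof (rule nn_integral_exp_centred_PiM_le)
    show "\<bar>?f x\<bar> \<le> b" if "x \<in> space (strip_law n)" for x
      using crossing_nonneg[of n x d k] strip_nonneg[OF that] k b by auto
    show "(\<integral>\<^sup>+t. ennreal (exp (s * (?f (x(i := t)) - ?f x))) \<partial>column_law) \<le> ennreal (exp s * \<kappa>)"
      if "i \<in> {..<n}" "x \<in> space (strip_law n)" for i x
      using that k by (intro truncated_crossing_resample) auto
  qed (use s_pos \<kappa>_nonneg l prob_space_column_law in auto)
  also have "\<dots> \<le> ennreal (exp (real n * ?K))"
  proof (rule ennreal_leI)
    have "(1 + ?K) ^ n \<le> exp ?K ^ n"
      using K0 by (intro power_mono exp_ge_add_one_self) auto
    then show "(1 + ?K) ^ card {..<n} \<le> exp (real n * ?K)" by (simp add: exp_of_nat_mult)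
  qed
  finally show ?thesis .
qed

end

section \<open>Concentration\<close>

text \<open>Borel-Cantelli for each tolerance \<open>1 / (j + 1)\<close>, then countably many
  tolerances at once.\<close>

lemma (in prob_space) AE_tendsto_if_exponential_tails:
  fixes X :: "nat \<Rightarrow> 'a \<Rightarrow> real"
  assumes [measurable]: "\<And>n. X n \<in> borel_measurable M"
    and lower: "\<And>\<epsilon>. 0 < \<epsilon> \<Longrightarrow> \<exists>A. \<exists>B>0. \<forall>\<^sub>F n in sequentially.
      prob {x \<in> space M. X n x \<le> real n * (c - \<epsilon>)} \<le> A * exp (- B * real n)"
    and upper: "\<And>\<epsilon>. 0 < \<epsilon> \<Longrightarrow> \<exists>A. \<exists>B>0. \<forall>\<^sub>F n in sequentially.
      prob {x \<in> space M. real n * (c + \<epsilon>) \<le> X n x} \<le> A * exp (- B * real n)"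
  shows "AE x in M. (\<lambda>n. X n x / real n) \<longlonglongrightarrow> c"
proof -
  have rare: "AE x in M. eventually (\<lambda>n. x \<in> space M - S n) sequentially"
    if [measurable]: "\<And>n. S n \<in> sets M" and "0 < B" "\<forall>\<^sub>F n in sequentially. prob (S n) \<le> A * exp (- B * real n)" for S A B
  proof (rule borel_cantelli_AE1)
    have "summable (\<lambda>n. A * exp (- B) ^ n)" using \<open>0 < B\<close> by (intro summable_mult summable_geometric) simp
    then show "summable (\<lambda>n. prob (S n))"
    proof (rule summable_comparison_test_ev[rotated])
      show "\<forall>\<^sub>F n in sequentially. norm (prob (S n)) \<le> A * exp (- B) ^ n"
        using that(3) by eventually_elim (simp add: exp_of_nat_mult[symmetric] mult.commute)
    qed
  qed (auto simp: emeasure_eq_measure)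
  have "AE x in M. \<forall>j. eventually (\<lambda>n. \<bar>X n x / real n - c\<bar> < inverse (real (Suc j))) sequentially"
  proof (subst AE_all_countable, intro allI)
    fix j
    let ?e = "inverse (real (Suc j))"
    obtain A B where AB: "0 < B" "\<forall>\<^sub>F n in sequentially. prob {x \<in> space M. X n x \<le> real n * (c - ?e)} \<le> A * exp (- B * real n)"
      using lower[of ?e] by auto
    obtain A' B' where AB': "0 < B'" "\<forall>\<^sub>F n in sequentially. prob {x \<in> space M. real n * (c + ?e) \<le> X n x} \<le> A' * exp (- B' * real n)"
      using upper[of ?e] by auto
    have "AE x in M. eventually (\<lambda>n. x \<in> space M - {x \<in> space M. X n x \<le> real n * (c - ?e)}) sequentially"
      by (rule rare[OF _ AB]) measurable
    moreover have "AE x in M. eventually (\<lambda>n. x \<in> space M - {x \<in> space M. real n * (c + ?e) \<le> X n x}) sequentially"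
      by (rule rare[OF _ AB']) measurable
    ultimately show "AE x in M. eventually (\<lambda>n. \<bar>X n x / real n - c\<bar> < ?e) sequentially"
    proof eventually_elim
      case (elim x)
      from elim eventually_gt_at_top[of 0] show ?case
      proof eventually_elim
        case (elim n)
        then have "real n * (c - ?e) < X n x" "X n x < real n * (c + ?e)" "0 < real n" by auto
        then have "c - ?e < X n x / real n" "X n x / real n < c + ?e"
          by (simp_all add: pos_less_divide_eq pos_divide_less_eq mult.commute del: of_nat_Suc)
        then show ?case by (simp add: abs_less_iff del: of_nat_Suc)
      qed
    qed
  qed
  then show ?thesis
  proof (rule AE_mp, intro AE_I2 impI)
    fix x assume conv: "\<forall>j. eventually (\<lambda>n. \<bar>X n x / real n - c\<bar> < inverse (real (Suc j))) sequentially"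
    show "(\<lambda>n. X n x / real n) \<longlonglongrightarrow> c"
    proof (rule tendstoI)
      fix e :: real assume "0 < e"
      then obtain j where "inverse (real (Suc j)) < e" using reals_Archimedean by blast
      with conv[rule_format, of j] show "eventually (\<lambda>n. dist (X n x / real n) c < e) sequentially"
        by (auto simp: dist_real_def elim!: eventually_mono)
    qed
  qed
qed

context light_crossings
begin

text \<open>Chernoff bound with parameter \<open>l\<close>. The condition on \<open>l\<close> makes
  the quadratic term at most half of the linear gain \<open>l * \<sigma>\<close>; taking
  \<open>c\<close> as 1 or -1 covers both tails.\<close>

lemma truncated_deviation:
  assumes k: "admissible d k" and b: "0 \<le> b" and l: "0 < l" "l \<le> s" "l * (exp s * \<kappa>) \<le> s\<^sup>2 * \<sigma> / 2"
    and c: "\<bar>c\<bar> = 1"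
  shows "measure (config G) {\<omega> \<in> space (config G).
      \<sigma> * real n \<le> c * (min b (crossing_time \<omega> n k) - (\<integral>\<omega>. min b (crossing_time \<omega> n k) \<partial>config G))}
    \<le> exp (- (l * \<sigma> / 2) * real n)"
proof -
  interpret prob_space "config G" by (rule prob_space_config)
  let ?m = "\<integral>\<omega>. min b (crossing_time \<omega> n k) \<partial>config G"
  let ?f = "\<lambda>\<omega>. c * (min b (crossing_time \<omega> n k) - ?m)"
  have "emeasure (config G) {\<omega> \<in> space (config G). \<sigma> * real n \<le> ?f \<omega>}
      \<le> ennreal (exp (- l * (\<sigma> * real n))) * (\<integral>\<^sup>+\<omega>\<in>space (config G). ennreal (exp (l * ?f \<omega>)) \<partial>config G)"
    using l by (intro Chernoff_ineq_nn_integral_ge) auto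
  also have "(\<integral>\<^sup>+\<omega>\<in>space (config G). ennreal (exp (l * ?f \<omega>)) \<partial>config G)
      = (\<integral>\<^sup>+\<omega>. ennreal (exp ((l * c) * (min b (crossing_time \<omega> n k) - ?m))) \<partial>config G)"
    by (intro nn_integral_cong) (simp add: mult.assoc)
  also have "\<dots> \<le> ennreal (exp (real n * ((l * c / s)\<^sup>2 * (exp s * \<kappa>))))"
    using l c by (intro truncated_mgf k b) (simp add: abs_mult)
  also have "\<dots> \<le> ennreal (exp (real n * (l * \<sigma> / 2)))"
  proof -
    have "c\<^sup>2 = 1" using c by (metis power2_abs power_one)
    then have "(l * c / s)\<^sup>2 * (exp s * \<kappa>) = l / s\<^sup>2 * (l * (exp s * \<kappa>))"
      by (simp add: power2_eq_square power_mult_distrib power_divide)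
    also have "\<dots> \<le> l / s\<^sup>2 * (s\<^sup>2 * \<sigma> / 2)"
      using l by (intro mult_left_mono) auto
    also have "\<dots> = l * \<sigma> / 2" using s_pos by simp
    finally show ?thesis by (intro ennreal_leI exp_le_cancel_iff[THEN iffD2] mult_left_mono) auto
  qed
  also have "ennreal (exp (- l * (\<sigma> * real n))) * ennreal (exp (real n * (l * \<sigma> / 2))) = ennreal (exp (- (l * \<sigma> / 2) * real n))"
    by (simp add: ennreal_mult[symmetric] exp_add[symmetric] field_simps)
  finally show ?thesis
    by (simp add: emeasure_eq_measure mult_left_mono)
qed

lemma truncated_mean_tendsto:
  assumes "admissible d k"
  shows "(\<lambda>j. \<integral>\<omega>. min (real j) (crossing_time \<omega> n k) \<partial>config G) \<longlonglongrightarrow> mean_time n k"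
proof (rule integral_dominated_convergence)
  show "integrable (config G) (\<lambda>\<omega>. crossing_time \<omega> n k)" by (rule integrable_crossing_time[OF assms])
  show "AE \<omega> in config G. (\<lambda>j. min (real j) (crossing_time \<omega> n k)) \<longlonglongrightarrow> crossing_time \<omega> n k"
  proof (rule AE_I2)
    fix \<omega>
    have "eventually (\<lambda>j. min (real j) (crossing_time \<omega> n k) = crossing_time \<omega> n k) sequentially"
      using eventually_ge_at_top[of "nat \<lceil>crossing_time \<omega> n k\<rceil>"]
      by eventually_elim (auto simp: min_def ceiling_le_iff nat_le_iff dest: order_antisym)
    then show "(\<lambda>j. min (real j) (crossing_time \<omega> n k)) \<longlonglongrightarrow> crossing_time \<omega> n k"
      by (rule tendsto_eventually)
  qed
  show "AE \<omega> in config G. norm (min (real j) (crossing_time \<omega> n k)) \<le> crossing_time \<omega> n k" for j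
    using crossing_time_nonneg assms by (intro AE_I2) auto
qed measurable

text \<open>The truncation is removed by choosing its level after \<open>n\<close> and
  \<open>k\<close>, since the rate in \<open>truncated_deviation\<close> does not depend on it.
  Hence \<open>B\<close> is uniform over all endpoints.\<close>

lemma deviation:
  assumes "0 < \<tau>"
  shows "\<exists>B>0. \<forall>n k. admissible d k \<longrightarrow>
    measure (config G) {\<omega> \<in> space (config G). crossing_time \<omega> n k \<le> mean_time n k - \<tau> * real n} \<le> exp (- B * real n) \<and>
    measure (config G) {\<omega> \<in> space (config G). mean_time n k + \<tau> * real n \<le> crossing_time \<omega> n k} \<le> exp (- B * real n)"
proof -
  interpret prob_space "config G" by (rule prob_space_config)
  define \<kappa>' where "\<kappa>' = exp s * \<kappa>"
  define \<sigma> where "\<sigma> = \<tau> / 2"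
  \<comment> \<open>Small enough for the Chernoff condition; the summand 1 keeps the denominator
    positive when \<open>\<kappa>'\<close> is 0.\<close>
  define l where "l = min s (s\<^sup>2 * \<sigma> / (2 * (\<kappa>' + 1)))"
  have \<kappa>': "0 \<le> \<kappa>'" using \<kappa>_nonneg by (simp add: \<kappa>'_def)
  have \<sigma>: "0 < \<sigma>" using assms by (simp add: \<sigma>_def)
  have l: "0 < l" "l \<le> s" using s_pos \<sigma> \<kappa>' by (auto simp: l_def)
  have "l * \<kappa>' \<le> s\<^sup>2 * \<sigma> / (2 * (\<kappa>' + 1)) * (\<kappa>' + 1)"
    using \<kappa>' \<sigma> s_pos by (intro mult_mono) (auto simp: l_def)
  also have "\<dots> = s\<^sup>2 * \<sigma> / 2" using \<kappa>' by (simp add: field_simps)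
  finally have l\<kappa>: "l * (exp s * \<kappa>) \<le> s\<^sup>2 * \<sigma> / 2" by (simp add: \<kappa>'_def)
  have "measure (config G) {\<omega> \<in> space (config G). crossing_time \<omega> n k \<le> mean_time n k - \<tau> * real n} \<le> exp (- (l * \<sigma> / 2) * real n) \<and>
    measure (config G) {\<omega> \<in> space (config G). mean_time n k + \<tau> * real n \<le> crossing_time \<omega> n k} \<le> exp (- (l * \<sigma> / 2) * real n)"
    if k: "admissible d k" for n k
  proof (cases "n = 0")
    case False
    let ?m = "\<lambda>j. \<integral>\<omega>. min (real j) (crossing_time \<omega> n k) \<partial>config G"
    have "eventually (\<lambda>j. mean_time n k - \<sigma> * real n < ?m j) sequentially"
      using truncated_mean_tendsto[OF k] False \<sigma> by (intro order_tendstoD(1)) auto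
    moreover have "eventually (\<lambda>j. mean_time n k + \<tau> * real n \<le> real j) sequentially"
      using filterlim_real_sequentially by (simp add: filterlim_at_top)
    \<comment> \<open>For the lower tail the truncated mean has to be within
      \<open>\<sigma> * real n\<close> of the mean; for the upper tail the level has to exceed the
      threshold, so that truncation does not hide the event.\<close>
    ultimately obtain j where j: "mean_time n k - \<sigma> * real n < ?m j" "mean_time n k + \<tau> * real n \<le> real j"
      using eventually_happens'[OF sequentially_bot eventually_conj] by blast
    have m_le: "?m j \<le> mean_time n k"
      using integrable_crossing_time[OF k] by (intro integral_mono integrable_min) auto
    have \<sigma>\<tau>: "\<tau> * real n = 2 * (\<sigma> * real n)" "0 \<le> \<sigma> * real n" using \<sigma> by (auto simp: \<sigma>_def)
    have "measure (config G) {\<omega> \<in> space (config G). crossing_time \<omega> n k \<le> mean_time n k - \<tau> * real n}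
        \<le> measure (config G) {\<omega> \<in> space (config G). \<sigma> * real n \<le> - 1 * (min (real j) (crossing_time \<omega> n k) - ?m j)}"
      using j \<sigma>\<tau> by (intro finite_measure_mono) auto
    also have "\<dots> \<le> exp (- (l * \<sigma> / 2) * real n)"
      by (rule truncated_deviation[OF k _ l l\<kappa>]) auto
    finally have 1: "measure (config G) {\<omega> \<in> space (config G). crossing_time \<omega> n k \<le> mean_time n k - \<tau> * real n}
        \<le> exp (- (l * \<sigma> / 2) * real n)" .
    have "measure (config G) {\<omega> \<in> space (config G). mean_time n k + \<tau> * real n \<le> crossing_time \<omega> n k}
        \<le> measure (config G) {\<omega> \<in> space (config G). \<sigma> * real n \<le> 1 * (min (real j) (crossing_time \<omega> n k) - ?m j)}"
      using j \<sigma>\<tau> m_le by (intro finite_measure_mono) auto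
    also have "\<dots> \<le> exp (- (l * \<sigma> / 2) * real n)"
      by (rule truncated_deviation[OF k _ l l\<kappa>]) auto
    finally show ?thesis using 1 by blast
  qed simp
  moreover have "0 < l * \<sigma> / 2" using l \<sigma> by simp
  ultimately show ?thesis by blast
qed

text \<open>Endpoint heights that are additive up to an error of 1. In the directed model they must
  be superadditive, because the end of a concatenated path can be corrected only upwards.\<close>

definition slope :: "(nat \<Rightarrow> int) \<Rightarrow> bool" where
  "slope h \<longleftrightarrow> (\<forall>n. admissible d (h n)) \<and>
    (\<forall>m n. \<bar>h (m + n) - (h m + h n)\<bar> \<le> 1 \<and> (d \<longrightarrow> h m + h n \<le> h (m + n)))"

definition speed :: "(nat \<Rightarrow> int) \<Rightarrow> real" where
  "speed h = lim (\<lambda>n. mean_time n (h n) / real n)"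

text \<open>Joining two crossings and correcting the final height costs at most 1, so
  \<open>approx_subadditive_limit\<close> applies with the same constant 1 for every
  \<open>h\<close>.\<close>

lemma
  assumes h: "slope h"
  shows speed_tendsto: "(\<lambda>n. mean_time n (h n) / real n) \<longlonglongrightarrow> speed h"
    and speed_le: "real n * speed h \<le> mean_time n (h n) + 1"
proof -
  have adm: "admissible d (h n)" for n using h by (simp add: slope_def)
  have sub: "mean_time (m + n) (h (m + n)) \<le> mean_time m (h m) + mean_time n (h n) + 1" for m n
  proof -
    have "\<bar>h (m + n) - (h m + h n)\<bar> \<le> 1" using h by (simp add: slope_def)
    then have "dist (h (m + n)) (h m + h n) \<le> 1" by (simp add: dist_real_def)
    moreover have "levels d (h m + h n) \<subseteq> levels d (h (m + n))" "admissible d (h m + h n)"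
      using h by (auto simp: slope_def levels_def)
    ultimately show ?thesis
      using mean_time_vertical[of "h m + h n" "h (m + n)" "m + n"] mean_time_subadditive[of "h m" "h n" m n] adm
      by force
  qed
  have nonneg: "0 \<le> mean_time n (h n)" for n
    using crossing_time_nonneg adm by (intro integral_nonneg_AE AE_I2) auto
  obtain c where c: "(\<lambda>n. mean_time n (h n) / real n) \<longlonglongrightarrow> c" "\<And>n. real n * c \<le> mean_time n (h n) + 1"
    using approx_subadditive_limit[of "\<lambda>n. mean_time n (h n)" 1] nonneg sub by auto
  have "speed h = c" unfolding speed_def using c(1) by (rule limI)
  then show "(\<lambda>n. mean_time n (h n) / real n) \<longlonglongrightarrow> speed h" "real n * speed h \<le> mean_time n (h n) + 1"
    using c by auto
qed

text \<open>One half of \<open>\<epsilon>\<close> absorbs the constant 1 in \<open>speed_le\<close>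
  once \<open>2 / \<epsilon> \<le> real n\<close>; the other half is a deviation from the mean. For
  smaller \<open>n\<close> the factor \<open>A\<close> makes the bound at least 1. Both constants
  are chosen before \<open>h\<close>, which gives uniformity in the direction.\<close>

lemma lower_tail:
  assumes "0 < \<epsilon>"
  shows "\<exists>A>0. \<exists>B>0. \<forall>h n. slope h \<longrightarrow>
    measure (config G) {\<omega> \<in> space (config G). crossing_time \<omega> n (h n) \<le> real n * (speed h - \<epsilon>)} \<le> A * exp (- B * real n)"
proof -
  interpret prob_space "config G" by (rule prob_space_config)
  obtain B where B: "0 < B" "\<And>n k. admissible d k \<Longrightarrow>
    measure (config G) {\<omega> \<in> space (config G). crossing_time \<omega> n k \<le> mean_time n k - \<epsilon> / 2 * real n} \<le> exp (- B * real n)"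
    using deviation[of "\<epsilon> / 2"] assms by auto
  have "measure (config G) {\<omega> \<in> space (config G). crossing_time \<omega> n (h n) \<le> real n * (speed h - \<epsilon>)}
      \<le> exp (B * (2 / \<epsilon>)) * exp (- B * real n)" if h: "slope h" for h n
  proof (cases "2 / \<epsilon> \<le> real n")
    case True
    then have "1 \<le> \<epsilon> / 2 * real n" using assms by (simp add: field_simps)
    then have "real n * (speed h - \<epsilon>) \<le> mean_time n (h n) - \<epsilon> / 2 * real n"
      using speed_le[OF h, of n] by (simp add: algebra_simps)
    then have "measure (config G) {\<omega> \<in> space (config G). crossing_time \<omega> n (h n) \<le> real n * (speed h - \<epsilon>)}
      \<le> measure (config G) {\<omega> \<in> space (config G). crossing_time \<omega> n (h n) \<le> mean_time n (h n) - \<epsilon> / 2 * real n}"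
      by (intro finite_measure_mono) auto
    also have "\<dots> \<le> 1 * exp (- B * real n)" using B(2) h by (simp add: slope_def)
    also have "\<dots> \<le> exp (B * (2 / \<epsilon>)) * exp (- B * real n)"
      using B(1) assms by (intro mult_right_mono) auto
    finally show ?thesis .
  next
    case False
    then have "0 \<le> B * (2 / \<epsilon> - real n)" using B(1) by simp
    then have "1 \<le> exp (B * (2 / \<epsilon>)) * exp (- B * real n)"
      by (simp add: exp_add[symmetric] algebra_simps)
    then show ?thesis using prob_le_1 order_trans by blast
  qed
  then show ?thesis using B(1) by (intro exI[of _ "exp (B * (2 / \<epsilon>))"] conjI exI[of _ B]) auto
qed

text \<open>The means converge at a rate that may depend on \<open>h\<close>, so the bound is
  asserted for large \<open>n\<close>; this suffices to identify the almost sure limit.\<close>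

lemma upper_tail:
  assumes "0 < \<epsilon>" and h: "slope h"
  shows "\<exists>B>0. \<forall>\<^sub>F n in sequentially.
    measure (config G) {\<omega> \<in> space (config G). real n * (speed h + \<epsilon>) \<le> crossing_time \<omega> n (h n)} \<le> exp (- B * real n)"
proof -
  interpret prob_space "config G" by (rule prob_space_config)
  obtain B where B: "0 < B" "\<And>n k. admissible d k \<Longrightarrow>
    measure (config G) {\<omega> \<in> space (config G). mean_time n k + \<epsilon> / 2 * real n \<le> crossing_time \<omega> n k} \<le> exp (- B * real n)"
    using deviation[of "\<epsilon> / 2"] assms by auto
  have "eventually (\<lambda>n. mean_time n (h n) / real n < speed h + \<epsilon> / 2) sequentially"
    using speed_tendsto[OF h] assms by (intro order_tendstoD(2)) auto
  then have "\<forall>\<^sub>F n in sequentially.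
    measure (config G) {\<omega> \<in> space (config G). real n * (speed h + \<epsilon>) \<le> crossing_time \<omega> n (h n)} \<le> exp (- B * real n)"
    using eventually_gt_at_top[of 0]
  proof eventually_elim
    case (elim n)
    then have "mean_time n (h n) + \<epsilon> / 2 * real n \<le> real n * (speed h + \<epsilon>)"
      by (simp add: field_simps)
    then have "measure (config G) {\<omega> \<in> space (config G). real n * (speed h + \<epsilon>) \<le> crossing_time \<omega> n (h n)}
      \<le> measure (config G) {\<omega> \<in> space (config G). mean_time n (h n) + \<epsilon> / 2 * real n \<le> crossing_time \<omega> n (h n)}"
      by (intro finite_measure_mono) auto
    also have "\<dots> \<le> exp (- B * real n)" using B(2) h by (simp add: slope_def)
    finally show ?case .
  qed
  then show ?thesis using B(1) by blast
qed

end

section \<open>Exponential moments of the crossing cost\<close>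

text \<open>Every weight is finite, so the probability of being at most \<open>j\<close> tends to
  1.\<close>

lemma (in weight_law) light_weights_exist:
  obtains L where "measure G {x \<in> space G. L < x} < 1 / 2"
proof -
  interpret prob_space G by (rule prob_space_G)
  have "(\<lambda>j. prob {x \<in> space G. x \<le> real j}) \<longlonglongrightarrow> prob (\<Union>j. {x \<in> space G. x \<le> real j})"
    by (intro finite_Lim_measure_incseq) (auto simp: incseq_def)
  also have "(\<Union>j. {x \<in> space G. x \<le> real j}) = space G"
    using real_arch_simple by auto
  finally have "\<forall>\<^sub>F j in sequentially. 1 / 2 < prob {x \<in> space G. x \<le> real j}"
    by (intro order_tendstoD(1)[of _ 1]) (auto simp: prob_space)
  then obtain j where j: "1 / 2 < prob {x \<in> space G. x \<le> real j}"
    using eventually_happens'[OF sequentially_bot] by blast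
  have "prob {x \<in> space G. \<not> x \<le> real j} = 1 - prob {x \<in> space G. x \<le> real j}"
    by (rule prob_neg) measurable
  then show ?thesis using j by (intro that[of "real j"]) (simp add: not_le)
qed

text \<open>Within distance \<open>j\<close> above \<open>y\<close> some weight is at most \<open>L\<close>, except with probability at
  most \<open>2 ^ - j\<close>.\<close>

lemma (in weight_law) light_crossings_undirected: "\<exists>s \<kappa>. light_crossings G False s \<kappa>"
proof -
  interpret prob_space G by (rule prob_space_G)
  interpret N: product_prob_space "\<lambda>_. G" "UNIV :: int set" by standard
  obtain L where L: "prob {x \<in> space G. L < x} < 1 / 2" by (rule light_weights_exist)
  define p where "p = prob {x \<in> space G. L < x}"
  \<comment> \<open>Going one row further costs a factor \<open>exp (2 * s) = 3 / 2\<close> and has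
    probability factor \<open>p < 1 / 2\<close>, so the ratio \<open>q\<close> of the geometric
    series is below 1.\<close>
  define s :: real where "s = ln (3 / 2) / 2"
  have s: "0 < s" "exp (2 * s) = 3 / 2" by (simp_all add: s_def)
  define q where "q = exp (2 * s) * p"
  have q: "0 \<le> q" "q < 1" using L by (auto simp: q_def p_def s(2))
  \<comment> \<open>\<open>c j\<close> is the exponential cost of using an edge of weight
    \<open>L\<close> at distance \<open>j\<close>, and \<open>Bad y j\<close> says that the
    \<open>j\<close> edges from height \<open>y\<close> upwards are heavier. Summing over all
    \<open>j\<close> dominates the term of the first light edge and stays integrable.\<close>
  define c where "c j = exp (s * (L + 2 * real j))" for j :: nat
  define Bad where "Bad y j = {t \<in> space column_law. \<forall>i\<in>{..<j}. L < t (y + int i)}" for y j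
  define E where "E y t = (\<Sum>j. ennreal (c j) * indicator (Bad y j) t)" for y :: int and t
  have Bad_meas [measurable]: "Bad y j \<in> sets column_law" for y j
    unfolding Bad_def by measurable
  have Bad: "emeasure column_law (Bad y j) = ennreal (p ^ j)" for y j
  proof -
    have "Bad y j = {t \<in> space column_law. \<forall>i\<in>(\<lambda>i. y + int i) ` {..<j}. t i \<in> {x \<in> space G. L < x}}"
      by (auto simp: Bad_def space_PiM)
    also have "emeasure column_law \<dots> = (\<Prod>i\<in>(\<lambda>i. y + int i) ` {..<j}. emeasure G {x \<in> space G. L < x})"
      by (rule N.emeasure_PiM_Collect) auto
    also have "\<dots> = ennreal (p ^ j)"
      by (simp add: card_image inj_on_def emeasure_eq_measure p_def ennreal_power)
    finally show ?thesis .
  qed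
  have int_E: "(\<integral>\<^sup>+t. E y t \<partial>column_law) = ennreal (exp (s * L) / (1 - q))" for y
  proof -
    have "(\<integral>\<^sup>+t. E y t \<partial>column_law) = (\<Sum>j. \<integral>\<^sup>+t. ennreal (c j) * indicator (Bad y j) t \<partial>column_law)"
      unfolding E_def by (rule nn_integral_suminf) measurable
    also have "\<dots> = (\<Sum>j. ennreal (exp (s * L) * q ^ j))"
    proof (rule suminf_cong)
      fix j
      have "c j * p ^ j = exp (s * L) * q ^ j"
        by (simp add: c_def q_def power_mult_distrib exp_of_nat_mult[symmetric] exp_add[symmetric] algebra_simps)
      then show "(\<integral>\<^sup>+t. ennreal (c j) * indicator (Bad y j) t \<partial>column_law) = ennreal (exp (s * L) * q ^ j)"
        using Bad_meas by (subst nn_integral_cmult_indicator) (auto simp: Bad ennreal_mult[symmetric] c_def p_def)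
    qed
    also have "\<dots> = ennreal (exp (s * L) / (1 - q))"
      using sums_mult[OF geometric_sums, of q "exp (s * L)"] q by (intro suminf_ennreal_eq) auto
    finally show ?thesis .
  qed
  have E_ge: "ennreal (exp (s * r)) \<le> E y t"
    if t: "t \<in> space column_law" and r: "\<And>z. r \<le> 2 * dist z y + t z" for t r and y :: int
  proof -
    have "\<exists>j. t \<in> Bad y j \<and> r \<le> L + 2 * real j"
    proof (cases "\<exists>j. t (y + int j) \<le> L")
      case True
      define j where "j = (LEAST j. t (y + int j) \<le> L)"
      have "t (y + int j) \<le> L" unfolding j_def using True by (rule LeastI_ex)
      moreover have "L < t (y + int i)" if "i < j" for i
        using not_less_Least[of i "\<lambda>j. t (y + int j) \<le> L"] that by (simp add: j_def)
      ultimately show ?thesis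
        using r[of "y + int j"] t by (intro exI[of _ j]) (auto simp: Bad_def dist_real_def)
    next
      case False
      \<comment> \<open>Without a light edge above \<open>y\<close> the column lies in every
        \<open>Bad y j\<close>, and \<open>j\<close> is taken large enough to dominate
        \<open>r\<close>.\<close>
      obtain j where "(r - L) / 2 \<le> real j" using real_arch_simple by blast
      then show ?thesis using False t by (intro exI[of _ j]) (auto simp: Bad_def not_le)
    qed
    then obtain j where j: "t \<in> Bad y j" "r \<le> L + 2 * real j" by blast
    define f where "f j = ennreal (c j) * indicator (Bad y j) t" for j
    have "ennreal (exp (s * r)) \<le> f j"
      using j s(1) by (auto simp: f_def c_def intro!: ennreal_leI)
    also have "\<dots> = sum f {j}" by simp
    also have "\<dots> \<le> suminf f" by (rule sum_le_suminf) auto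
    also have "\<dots> = E y t" by (simp add: E_def f_def[abs_def])
    finally show ?thesis .
  qed
  have "light_crossings G False s (exp (s * L) / (1 - q))"
  proof
    fix y :: int
    show "\<exists>E\<in>borel_measurable column_law. (\<integral>\<^sup>+t. E t \<partial>column_law) \<le> ennreal (exp (s * L) / (1 - q)) \<and>
      (\<forall>t\<in>space column_law. \<forall>r. (\<forall>z\<in>detours False y. r \<le> 2 * dist z y + t z) \<longrightarrow> ennreal (exp (s * r)) \<le> E t)"
    proof (intro bexI[of _ "E y"] conjI ballI allI impI)
      show "(\<integral>\<^sup>+t. E y t \<partial>column_law) \<le> ennreal (exp (s * L) / (1 - q))" by (simp add: int_E)
      show "ennreal (exp (s * r)) \<le> E y t"
        if "t \<in> space column_law" "\<forall>z\<in>detours False y. r \<le> 2 * dist z y + t z" for t r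
        using that by (intro E_ge) (auto simp: detours_def)
      show "E y \<in> borel_measurable column_law" unfolding E_def by measurable
    qed
  qed (use s q in auto)
  then show ?thesis by blast
qed

text \<open>Two-point weights are almost surely at most \<open>max a b\<close>, and the only detour
  is the edge itself, so \<open>exp (t y)\<close> serves as \<open>E\<close>.\<close>

lemma (in weight_law) light_crossings_directed:
  assumes "measure G {a, b} = 1"
  shows "light_crossings G True 1 (exp (max a b))"
proof
  interpret prob_space G by (rule prob_space_G)
  interpret N: prob_space column_law by (rule prob_space_column_law)
  fix y :: int
  have "AE x in G. x \<in> {a, b}" using assms by (rule AE_prob_1)
  then have "AE t in column_law. t y \<in> {a, b}"
    using prob_space_G by (intro AE_PiM_component) auto
  then have "(\<integral>\<^sup>+t. ennreal (exp (t y)) \<partial>column_law) \<le> (\<integral>\<^sup>+t. ennreal (exp (max a b)) \<partial>column_law)"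
    by (intro nn_integral_mono_AE) (auto elim!: eventually_mono)
  also have "\<dots> = ennreal (exp (max a b))" by (simp add: N.emeasure_space_1)
  finally have "(\<integral>\<^sup>+t. ennreal (exp (t y)) \<partial>column_law) \<le> ennreal (exp (max a b))" .
  then show "\<exists>E\<in>borel_measurable column_law. (\<integral>\<^sup>+t. E t \<partial>column_law) \<le> ennreal (exp (max a b)) \<and>
      (\<forall>t\<in>space column_law. \<forall>r. (\<forall>z\<in>detours True y. r \<le> 2 * dist z y + t z) \<longrightarrow> ennreal (exp (1 * r)) \<le> E t)"
    by (intro bexI[of _ "\<lambda>t. ennreal (exp (t y))"]) (auto simp: detours_def intro!: ennreal_leI)
qed auto

section \<open>Directed paths: the cost of ending one row lower\<close>

primrec backlog :: "(nat \<Rightarrow> int \<Rightarrow> real) \<Rightarrow> int \<Rightarrow> nat \<Rightarrow> real" where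
  "backlog W k 0 = 0"
| "backlog W k (Suc n) = max 0 (backlog W k n + (W n k - W n (k + 1)))"

lemma backlog_nonneg: "0 \<le> backlog W k n"
  by (cases n) auto

lemma backlog_cong: "(\<And>i. i < n \<Longrightarrow> W i = W' i) \<Longrightarrow> backlog W k n = backlog W' k n"
  by (induction n) auto

text \<open>The backlog is the maximum over \<open>j\<close> of the sums of \<open>W i k - W i (k + 1)\<close> over \<open>j \<le> i < n\<close>, that is,
  the largest possible cost of pushing the last stretch of a directed path down from row \<open>k + 1\<close>
  to row \<open>k\<close>.\<close>

lemma crossing_directed_le_next:
  assumes "\<And>i y. i < n \<Longrightarrow> 0 \<le> W i y" "0 \<le> k"
  shows "crossing True W n k \<le> crossing True W n (k + 1) + backlog W k n"
  using assms
proof (induction n)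
  case (Suc n)
  have W: "0 \<le> W i y" if "i \<le> n" for i y using Suc.prems that by auto
  have "crossing True W (Suc n) k - backlog W k (Suc n)
      \<le> crossing True W n y + W n y + dist (k + 1) y" if y: "y \<in> levels True (k + 1)" for y
  proof (cases "y = k + 1")
    \<comment> \<open>The last column is crossed in row \<open>k + 1\<close>: moving this crossing
      down exchanges its weight, and the induction hypothesis moves the part before it.\<close>
    case True
    have "crossing True W (Suc n) k \<le> crossing True W n k + W n k + dist k k"
      using W Suc.prems(2) by (intro crossing_Suc_le) (auto simp: levels_def)
    moreover have "crossing True W n k \<le> crossing True W n (k + 1) + backlog W k n"
      using Suc by auto
    ultimately show ?thesis using True by simp
  next
    \<comment> \<open>The last column is crossed at height at most \<open>k\<close>, so only the
      final vertical stretch shortens.\<close>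
    case False
    then have "crossing True W (Suc n) k \<le> crossing True W n y + W n y + dist k y"
      using W y by (intro crossing_Suc_le) (auto simp: levels_def)
    moreover have "dist k y \<le> dist (k + 1) y" using y False by (auto simp: levels_def dist_real_def)
    ultimately show ?thesis using backlog_nonneg[of W k "Suc n"] by linarith
  qed
  then have "crossing True W (Suc n) k - backlog W k (Suc n) \<le> crossing True W (Suc n) (k + 1)"
    unfolding crossing.simps(2)[of True W n "k + 1"] using Suc.prems(2)
    by (intro cINF_greatest) (auto simp: levels_def)
  then show ?case by linarith
qed simp

locale directed_light_crossings = light_crossings G True s \<kappa> for G s \<kappa>
begin

text \<open>A directed detour is the edge itself, so the hypothesis at height 0 yields an
  exponential moment of \<open>G\<close>.\<close>

lemma exp_moment: "(\<integral>\<^sup>+x. ennreal (exp (s * x)) \<partial>G) \<le> ennreal \<kappa>"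
proof -
  obtain E where E: "(\<integral>\<^sup>+t. E t \<partial>column_law) \<le> ennreal \<kappa>"
    and E_ge: "\<forall>t \<in> space column_law. \<forall>r. (\<forall>z\<in>detours True 0. r \<le> 2 * dist z (real_of_int 0) + t z)
        \<longrightarrow> ennreal (exp (s * r)) \<le> E t"
    using cheap_crossing[of 0] by (elim bexE conjE) (rule that; assumption)
  have "(\<integral>\<^sup>+x. ennreal (exp (s * x)) \<partial>G) = (\<integral>\<^sup>+t. ennreal (exp (s * t 0)) \<partial>column_law)"
    using nn_integral_distr[of "\<lambda>t. t 0" column_law G "\<lambda>x. ennreal (exp (s * x))"]
      distr_PiM_component[of UNIV "\<lambda>_. G" "0 :: int"] prob_space_G by simp
  also have "\<dots> \<le> (\<integral>\<^sup>+t. E t \<partial>column_law)"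
    using E_ge by (intro nn_integral_mono) (auto simp: detours_def)
  finally show ?thesis using E by simp
qed

text \<open>Adjacent weights of a column are independent with law \<open>G\<close>, so their
  difference is already symmetric and \<open>nn_integral_exp_diff_le\<close> applies without
  centring. Subtracting a nonnegative weight only helps, which reduces its hypothesis to
  \<open>exp_moment\<close>.\<close>

lemma neighbour_mgf:
  assumes "\<bar>l\<bar> \<le> s"
  shows "(\<integral>\<^sup>+t. ennreal (exp (l * (t k - t (k + 1)))) \<partial>column_law) \<le> ennreal (1 + (l / s)\<^sup>2 * \<kappa>)"
proof -
  interpret prob_space G by (rule prob_space_G)
  interpret GG: pair_prob_space G G ..
  interpret N: product_prob_space "\<lambda>_. G" "UNIV :: int set" by standard
  let ?f = "\<lambda>x y. ennreal (exp (l * (x - y)))"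
  have "distr column_law (Pi\<^sub>M {k, k + 1} (\<lambda>_. G)) (\<lambda>t. restrict t {k, k + 1}) = Pi\<^sub>M {k, k + 1} (\<lambda>_. G)"
    using distr_PiM_reindex[of UNIV "\<lambda>_. G" "\<lambda>y. y" "{k, k + 1}"] prob_space_G by simp
  moreover have "(\<lambda>t. restrict t {k, k + 1}) \<in> measurable column_law (Pi\<^sub>M {k, k + 1} (\<lambda>_. G))"
    by (rule measurable_restrict_subset) simp
  moreover have "(\<lambda>\<sigma>. \<sigma> i) \<in> borel_measurable (Pi\<^sub>M {k, k + 1} (\<lambda>_. G))" if "i \<in> {k, k + 1}" for i
    by (rule measurable_compose[where f = "\<lambda>\<sigma>. \<sigma> i", OF measurable_component_singleton[OF that] measurable_id_G])
  ultimately have "(\<integral>\<^sup>+t. ?f (t k) (t (k + 1)) \<partial>column_law) = (\<integral>\<^sup>+\<sigma>. ?f (\<sigma> k) (\<sigma> (k + 1)) \<partial>Pi\<^sub>M {k, k + 1} (\<lambda>_. G))"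
    using nn_integral_distr[of "\<lambda>t. restrict t {k, k + 1}" column_law "Pi\<^sub>M {k, k + 1} (\<lambda>_. G)" "\<lambda>\<sigma>. ?f (\<sigma> k) (\<sigma> (k + 1))"]
    by simp
  also have "\<dots> = (\<integral>\<^sup>+z. ?f (fst z) (snd z) \<partial>(G \<Otimes>\<^sub>M G))"
    by (rule N.product_nn_integral_pair) measurable
  also have "\<dots> = (\<integral>\<^sup>+x'. \<integral>\<^sup>+x. ?f x x' \<partial>G \<partial>G)"
    by (subst GG.nn_integral_snd[symmetric]) measurable
  also have "\<dots> \<le> ennreal (1 + (l / s)\<^sup>2 * \<kappa>)"
  proof (rule nn_integral_exp_diff_le)
    fix x' assume "x' \<in> space G"
    then have "0 \<le> x'" by (simp add: space_G)
    then have "(\<integral>\<^sup>+x. ennreal (exp (s * (x - x'))) \<partial>G) \<le> (\<integral>\<^sup>+x. ennreal (exp (s * x)) \<partial>G)"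
      using s_pos by (intro nn_integral_mono ennreal_leI) simp
    then show "(\<integral>\<^sup>+x. ennreal (exp (s * (x - x'))) \<partial>G) \<le> ennreal \<kappa>" using exp_moment by order
  qed (use assms s_pos \<kappa>_nonneg in auto)
  finally show ?thesis .
qed

lemma backlog_measurable_strip: "n \<le> m \<Longrightarrow> (\<lambda>x. backlog x k n) \<in> borel_measurable (strip_law m)"
  by (induction n) (auto intro!: borel_measurable_max borel_measurable_add borel_measurable_diff measurable_strip)

lemma backlog_measurable [measurable]: "(\<lambda>\<omega>. backlog (column_weights \<omega>) k n) \<in> borel_measurable (config G)"
  by (induction n) (auto simp: column_weights_def)

text \<open>By \<open>exp (max 0 a) \<le> 1 + exp a\<close> each new column multiplies the bound by
  the factor of \<open>neighbour_mgf\<close> and adds 1. That factor is at least 1, so the total is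
  at most \<open>Suc n\<close> times its \<open>n\<close>-th power.\<close>

lemma backlog_mgf:
  assumes l: "0 \<le> l" "l \<le> s"
  shows "(\<integral>\<^sup>+x. ennreal (exp (l * backlog x k n)) \<partial>strip_law n)
    \<le> ennreal (real (Suc n) * (1 + (l / s)\<^sup>2 * \<kappa>) ^ n)"
proof (induction n)
  case 0
  interpret prob_space "strip_law 0" by (rule prob_space_strip_law)
  show ?case using emeasure_space_1 by simp
next
  case (Suc n)
  interpret N: prob_space column_law by (rule prob_space_column_law)
  interpret P: prob_space "strip_law n" by (rule prob_space_strip_law)
  interpret Q: product_prob_space "\<lambda>_. column_law" "{..<n}" by standard
  let ?K = "1 + (l / s)\<^sup>2 * \<kappa>"
  have K: "1 \<le> ?K" using \<kappa>_nonneg by simp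
  have eq: "{..<Suc n} = insert n {..<n}" by auto
  note [measurable] = backlog_measurable_strip[OF order_refl, of k n]
  have meas: "(\<lambda>x. ennreal (exp (l * backlog x k (Suc n)))) \<in> borel_measurable (Pi\<^sub>M (insert n {..<n}) (\<lambda>_. column_law))"
    by (rule measurable_compose[OF backlog_measurable_strip[OF order_refl, of k "Suc n", unfolded eq]]) measurable
  have "(\<integral>\<^sup>+x. ennreal (exp (l * backlog x k (Suc n))) \<partial>strip_law (Suc n))
      = (\<integral>\<^sup>+x. \<integral>\<^sup>+t. ennreal (exp (l * backlog (x(n := t)) k (Suc n))) \<partial>column_law \<partial>strip_law n)"
    unfolding eq by (rule Q.product_nn_integral_insert[OF _ _ meas]) auto
  also have "\<dots> \<le> (\<integral>\<^sup>+x. \<integral>\<^sup>+t. 1 + ennreal (exp (l * backlog x k n)) * ennreal (exp (l * (t k - t (k + 1)))) \<partial>column_law \<partial>strip_law n)"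
  proof (intro nn_integral_mono)
    fix x and t :: "int \<Rightarrow> real"
    have "backlog (x(n := t)) k n = backlog x k n" by (rule backlog_cong) simp
    then have "exp (l * backlog (x(n := t)) k (Suc n)) \<le> 1 + exp (l * backlog x k n) * exp (l * (t k - t (k + 1)))"
      by (auto simp: max_def exp_add[symmetric] distrib_left)
    then have "ennreal (exp (l * backlog (x(n := t)) k (Suc n))) \<le> ennreal (1 + exp (l * backlog x k n) * exp (l * (t k - t (k + 1))))"
      by (rule ennreal_leI)
    then show "ennreal (exp (l * backlog (x(n := t)) k (Suc n)))
        \<le> 1 + ennreal (exp (l * backlog x k n)) * ennreal (exp (l * (t k - t (k + 1))))"
      by (simp add: ennreal_mult)
  qed
  also have "\<dots> = (\<integral>\<^sup>+x. 1 + ennreal (exp (l * backlog x k n)) * (\<integral>\<^sup>+t. ennreal (exp (l * (t k - t (k + 1)))) \<partial>column_law) \<partial>strip_law n)"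
    by (intro nn_integral_cong) (simp add: nn_integral_add nn_integral_cmult N.emeasure_space_1)
  also have "\<dots> \<le> (\<integral>\<^sup>+x. 1 + ennreal (exp (l * backlog x k n)) * ennreal ?K \<partial>strip_law n)"
    using l by (intro nn_integral_mono add_left_mono mult_left_mono neighbour_mgf) auto
  also have "\<dots> = 1 + (\<integral>\<^sup>+x. ennreal (exp (l * backlog x k n)) \<partial>strip_law n) * ennreal ?K"
    by (subst nn_integral_add; simp add: nn_integral_multc P.emeasure_space_1)
  also have "\<dots> \<le> 1 + ennreal (real (Suc n) * ?K ^ n) * ennreal ?K"
    by (intro add_left_mono mult_right_mono Suc.IH) auto
  also have "\<dots> = ennreal (1 + real (Suc n) * ?K ^ Suc n)"
    using K by (subst ennreal_mult[symmetric]) (auto simp: mult_ac)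
  also have "\<dots> \<le> ennreal (real (Suc (Suc n)) * ?K ^ Suc n)"
  proof (rule ennreal_leI)
    have "1 \<le> ?K ^ Suc n" using K by (rule one_le_power)
    then show "1 + real (Suc n) * ?K ^ Suc n \<le> real (Suc (Suc n)) * ?K ^ Suc n"
      by (simp only: of_nat_Suc distrib_right)
  qed
  finally show ?case .
qed

text \<open>Chernoff bound as for crossing times, with the extra factor \<open>Suc n\<close> paid
  for by half of the remaining rate. All rows have the same law, so the constants are uniform in
  \<open>k\<close>.\<close>

lemma backlog_tail:
  assumes \<sigma>: "0 < \<sigma>"
  shows "\<exists>A>0. \<exists>B>0. \<forall>n k. measure (config G) {\<omega> \<in> space (config G). \<sigma> * real n \<le> backlog (column_weights \<omega>) k n}
    \<le> A * exp (- B * real n)"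
proof -
  interpret prob_space "config G" by (rule prob_space_config)
  define l where "l = min s (s\<^sup>2 * \<sigma> / (2 * (\<kappa> + 1)))"
  have l: "0 < l" "l \<le> s" using s_pos \<sigma> \<kappa>_nonneg by (auto simp: l_def)
  have "l * \<kappa> \<le> s\<^sup>2 * \<sigma> / (2 * (\<kappa> + 1)) * (\<kappa> + 1)"
    using \<kappa>_nonneg \<sigma> s_pos by (intro mult_mono) (auto simp: l_def)
  also have "\<dots> = s\<^sup>2 * \<sigma> / 2" using \<kappa>_nonneg by (simp add: field_simps)
  finally have "l / s\<^sup>2 * (l * \<kappa>) \<le> l / s\<^sup>2 * (s\<^sup>2 * \<sigma> / 2)"
    using l by (intro mult_left_mono) auto
  then have l\<kappa>: "(l / s)\<^sup>2 * \<kappa> \<le> l * \<sigma> / 2"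
    using s_pos by (simp add: power2_eq_square)
  \<comment> \<open>The quadratic term uses half of the rate \<open>l * \<sigma>\<close>, the factor
    \<open>Suc n\<close> a quarter, and a quarter remains.\<close>
  define B where "B = l * \<sigma> / 4"
  have B: "0 < B" using l \<sigma> by (simp add: B_def)
  have "prob {\<omega> \<in> space (config G). \<sigma> * real n \<le> backlog (column_weights \<omega>) k n} \<le> (1 + 1 / B) * exp (- B * real n)" for n k
  proof -
    note [measurable] = backlog_measurable_strip[OF order_refl, of k n]
    have "emeasure (config G) {\<omega> \<in> space (config G). \<sigma> * real n \<le> backlog (column_weights \<omega>) k n}
        \<le> ennreal (exp (- l * (\<sigma> * real n))) * (\<integral>\<^sup>+\<omega>\<in>space (config G). ennreal (exp (l * backlog (column_weights \<omega>) k n)) \<partial>config G)"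
      using l by (intro Chernoff_ineq_nn_integral_ge) auto
    also have "(\<integral>\<^sup>+\<omega>\<in>space (config G). ennreal (exp (l * backlog (column_weights \<omega>) k n)) \<partial>config G)
        = (\<integral>\<^sup>+x. ennreal (exp (l * backlog x k n)) \<partial>strip_law n)"
      by (subst nn_integral_strip, measurable)
        (auto intro!: nn_integral_cong arg_cong[where f = "\<lambda>r. ennreal (exp (l * r))"] backlog_cong)
    also have "\<dots> \<le> ennreal (real (Suc n) * (1 + (l / s)\<^sup>2 * \<kappa>) ^ n)"
      using l by (intro backlog_mgf) auto
    also have "\<dots> \<le> ennreal (((1 + 1 / B) * exp (B * real n)) * exp (real n * (l * \<sigma> / 2)))"
    proof (intro ennreal_leI mult_mono)
      have "real (Suc n) \<le> (1 + 1 / B) * (1 + B * real n)" using B by (simp add: field_simps)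
      also have "\<dots> \<le> (1 + 1 / B) * exp (B * real n)"
        using B by (intro mult_left_mono exp_ge_add_one_self) auto
      finally show "real (Suc n) \<le> (1 + 1 / B) * exp (B * real n)" .
      have "(1 + (l / s)\<^sup>2 * \<kappa>) ^ n \<le> exp (l * \<sigma> / 2) ^ n"
        using l\<kappa> \<kappa>_nonneg by (intro power_mono order_trans[OF exp_ge_add_one_self]) auto
      then show "(1 + (l / s)\<^sup>2 * \<kappa>) ^ n \<le> exp (real n * (l * \<sigma> / 2))" by (simp only: exp_of_nat_mult)
    qed (use B \<kappa>_nonneg in auto)
    also have "ennreal (exp (- l * (\<sigma> * real n))) * ennreal (((1 + 1 / B) * exp (B * real n)) * exp (real n * (l * \<sigma> / 2)))
        = ennreal ((1 + 1 / B) * exp (- B * real n))"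
    proof (subst ennreal_mult[symmetric])
      have "exp (- l * (\<sigma> * real n)) * (((1 + 1 / B) * exp (B * real n)) * exp (real n * (l * \<sigma> / 2)))
        = (1 + 1 / B) * exp (- l * (\<sigma> * real n) + B * real n + real n * (l * \<sigma> / 2))"
        by (simp only: exp_add mult_ac)
      also have "- l * (\<sigma> * real n) + B * real n + real n * (l * \<sigma> / 2) = - B * real n"
        by (simp add: B_def field_simps)
      finally show "ennreal (exp (- l * (\<sigma> * real n)) * (((1 + 1 / B) * exp (B * real n)) * exp (real n * (l * \<sigma> / 2))))
        = ennreal ((1 + 1 / B) * exp (- B * real n))" by (rule arg_cong)
    qed (use B in auto)
    finally show ?thesis
      using B by (simp add: emeasure_eq_measure mult_left_mono)
  qed
  moreover have "0 < 1 + 1 / B" using B by (simp add: add_pos_pos)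
  ultimately show ?thesis using B by blast
qed

end

section \<open>Identification of the limits\<close>

text \<open>Two almost sure limits are attained at a common point, because a probability space is
  not null.\<close>

lemma (in prob_space) THE_AE_limit:
  fixes X :: "nat \<Rightarrow> 'a \<Rightarrow> real"
  assumes "AE x in M. (\<lambda>n. X n x) \<longlonglongrightarrow> c"
  shows "(THE c. AE x in M. (\<lambda>n. X n x) \<longlonglongrightarrow> c) = c"
proof (rule the_equality, rule assms)
  fix c' assume "AE x in M. (\<lambda>n. X n x) \<longlonglongrightarrow> c'"
  with assms have "AE x in M. c' = c" by eventually_elim (rule LIMSEQ_unique)
  then show "c' = c" by simp
qed

context light_crossings
begin

lemma AE_crossing_time_tendsto:
  assumes "slope h"
  shows "AE \<omega> in config G. (\<lambda>n. crossing_time \<omega> n (h n) / real n) \<longlonglongrightarrow> speed h"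
proof -
  interpret prob_space "config G" by (rule prob_space_config)
  show ?thesis
  proof (rule AE_tendsto_if_exponential_tails)
    fix \<epsilon> :: real assume \<epsilon>: "0 < \<epsilon>"
    show "\<exists>A. \<exists>B>0. \<forall>\<^sub>F n in sequentially.
        prob {\<omega> \<in> space (config G). crossing_time \<omega> n (h n) \<le> real n * (speed h - \<epsilon>)} \<le> A * exp (- B * real n)"
      using lower_tail[OF \<epsilon>] assms by (meson always_eventually)
    show "\<exists>A. \<exists>B>0. \<forall>\<^sub>F n in sequentially.
        prob {\<omega> \<in> space (config G). real n * (speed h + \<epsilon>) \<le> crossing_time \<omega> n (h n)} \<le> A * exp (- B * real n)"
      using upper_tail[OF \<epsilon> assms] by - (rule exI[of _ 1], simp only: mult_1)
  qed measurable
qed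

end

section \<open>The undirected model\<close>

locale undirected_light_crossings = light_crossings G False s \<kappa> for G s \<kappa>
begin

lemma slope_ceiling: "slope (\<lambda>n. \<lceil>v * real n\<rceil>)"
  unfolding slope_def
proof (intro conjI allI)
  fix m n
  have "v * real (m + n) = v * real m + v * real n" by (simp add: algebra_simps)
  then show "\<bar>\<lceil>v * real (m + n)\<rceil> - (\<lceil>v * real m\<rceil> + \<lceil>v * real n\<rceil>)\<bar> \<le> 1" by linarith
qed auto

lemma passage_eq:
  "\<omega> \<in> space (config G) \<Longrightarrow> passage \<omega> (0, 0) (endpoint v n) = crossing_time \<omega> n \<lceil>v * real n\<rceil>"
  using passage_eq_crossing[of \<omega> n] config_nonneg by (simp add: endpoint_def)

lemma Lambda_eq_speed: "Lambda G v = speed (\<lambda>n. \<lceil>v * real n\<rceil>)"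
  unfolding Lambda_def
proof (rule prob_space.THE_AE_limit[OF prob_space_config])
  show "AE \<omega> in config G. (\<lambda>n. passage \<omega> (0, 0) (endpoint v n) / real n) \<longlonglongrightarrow> speed (\<lambda>n. \<lceil>v * real n\<rceil>)"
    using AE_crossing_time_tendsto[OF slope_ceiling] AE_space by eventually_elim (simp add: passage_eq)
qed

lemma passage_lower_tail:
  assumes "0 < \<epsilon>"
  shows "\<exists>A>0. \<exists>B>0. \<forall>n v. measure (config G) {\<omega> \<in> space (config G).
    passage \<omega> (0, 0) (endpoint v n) \<le> real n * (Lambda G v - \<epsilon>)} \<le> A * exp (- B * real n)"
proof -
  obtain A B where AB: "0 < A" "0 < B" "\<And>h n. slope h \<Longrightarrow>
    measure (config G) {\<omega> \<in> space (config G). crossing_time \<omega> n (h n) \<le> real n * (speed h - \<epsilon>)} \<le> A * exp (- B * real n)"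
    using lower_tail[OF assms] by blast
  have "{\<omega> \<in> space (config G). passage \<omega> (0, 0) (endpoint v n) \<le> real n * (Lambda G v - \<epsilon>)}
    = {\<omega> \<in> space (config G). crossing_time \<omega> n \<lceil>v * real n\<rceil> \<le> real n * (speed (\<lambda>n. \<lceil>v * real n\<rceil>) - \<epsilon>)}" for n v
    using passage_eq Lambda_eq_speed by auto
  then show ?thesis using AB(1,2) AB(3)[OF slope_ceiling] by auto
qed

end

section \<open>The directed model: from floors to ceilings\<close>

context directed_light_crossings
begin

text \<open>Floors are superadditive, as directed concatenation requires; ceilings in general are
  not.\<close>

lemma slope_floor: "0 \<le> v \<Longrightarrow> slope (\<lambda>n. \<lfloor>v * real n\<rfloor>)"
  unfolding slope_def
proof (intro conjI allI impI)
  fix m n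
  have "v * real (m + n) = v * real m + v * real n" by (simp add: algebra_simps)
  then show "\<bar>\<lfloor>v * real (m + n)\<rfloor> - (\<lfloor>v * real m\<rfloor> + \<lfloor>v * real n\<rfloor>)\<bar> \<le> 1"
    "\<lfloor>v * real m\<rfloor> + \<lfloor>v * real n\<rfloor> \<le> \<lfloor>v * real (m + n)\<rfloor>" by linarith+
qed auto

lemma passage_dir_eq:
  assumes "\<omega> \<in> space (config G)" "0 \<le> v"
  shows "passage_dir \<omega> (0, 0) (endpoint v n) = crossing_time \<omega> n \<lceil>v * real n\<rceil>"
proof -
  have "0 \<le> v * real n" using assms(2) by simp
  then have "0 \<le> \<lceil>v * real n\<rceil>" by linarith
  then show ?thesis
    using passage_dir_eq_crossing[of \<omega> _ n] config_nonneg[OF assms(1)] by (simp add: endpoint_def)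
qed

text \<open>The ceiling is the floor or one more. Going up costs one vertical edge, going down costs
  at most the backlog.\<close>

lemma
  assumes \<omega>: "\<omega> \<in> space (config G)" and "0 \<le> v"
  shows passage_dir_le_floor: "passage_dir \<omega> (0, 0) (endpoint v n) \<le> crossing_time \<omega> n \<lfloor>v * real n\<rfloor> + 1"
    and floor_le_passage_dir: "crossing_time \<omega> n \<lfloor>v * real n\<rfloor>
      \<le> passage_dir \<omega> (0, 0) (endpoint v n) + backlog (column_weights \<omega>) \<lfloor>v * real n\<rfloor> n"
proof -
  let ?k = "\<lfloor>v * real n\<rfloor>"
  have k: "0 \<le> ?k" using assms(2) by simp
  have W: "0 \<le> column_weights \<omega> i y" for i y by (rule weights_nonneg[OF \<omega>])
  have "\<lceil>v * real n\<rceil> = ?k \<or> \<lceil>v * real n\<rceil> = ?k + 1" by linarith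
  moreover have "crossing_time \<omega> n (?k + 1) \<le> crossing_time \<omega> n ?k + dist (?k + 1) ?k"
    using k by (intro crossing_le_vertical W) (auto simp: levels_def)
  moreover have "crossing_time \<omega> n ?k \<le> crossing_time \<omega> n (?k + 1) + backlog (column_weights \<omega>) ?k n"
    by (intro crossing_directed_le_next W k)
  ultimately show "passage_dir \<omega> (0, 0) (endpoint v n) \<le> crossing_time \<omega> n ?k + 1"
    "crossing_time \<omega> n ?k \<le> passage_dir \<omega> (0, 0) (endpoint v n) + backlog (column_weights \<omega>) ?k n"
    using passage_dir_eq[OF assms] backlog_nonneg[of "column_weights \<omega>" ?k n] by (auto simp: dist_real_def)
qed

lemma passage_dir_measurable:
  assumes "0 \<le> v"
  shows "(\<lambda>\<omega>. passage_dir \<omega> (0, 0) (endpoint v n)) \<in> borel_measurable (config G)"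
  using crossing_measurable assms by (subst measurable_cong[OF passage_dir_eq]) auto

text \<open>An unusually fast path to the ceiling forces either an unusually fast path to the floor
  or a large backlog; each event takes half of \<open>\<epsilon>\<close>.\<close>

lemma passage_dir_lower_tail_speed:
  assumes "0 < \<epsilon>"
  shows "\<exists>A>0. \<exists>B>0. \<forall>n v. 0 \<le> v \<longrightarrow> measure (config G) {\<omega> \<in> space (config G).
    passage_dir \<omega> (0, 0) (endpoint v n) \<le> real n * (speed (\<lambda>n. \<lfloor>v * real n\<rfloor>) - \<epsilon>)} \<le> A * exp (- B * real n)"
proof -
  interpret prob_space "config G" by (rule prob_space_config)
  have \<epsilon>: "0 < \<epsilon> / 2" using assms by simp
  obtain A B where AB: "0 < A" "0 < B" "\<And>h n. slope h \<Longrightarrow>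
    prob {\<omega> \<in> space (config G). crossing_time \<omega> n (h n) \<le> real n * (speed h - \<epsilon> / 2)} \<le> A * exp (- B * real n)"
    using lower_tail[OF \<epsilon>] by blast
  obtain A' B' where AB': "0 < A'" "0 < B'" "\<And>n k.
    prob {\<omega> \<in> space (config G). \<epsilon> / 2 * real n \<le> backlog (column_weights \<omega>) k n} \<le> A' * exp (- B' * real n)"
    using backlog_tail[OF \<epsilon>] by blast
  have "prob {\<omega> \<in> space (config G). passage_dir \<omega> (0, 0) (endpoint v n) \<le> real n * (speed (\<lambda>n. \<lfloor>v * real n\<rfloor>) - \<epsilon>)}
      \<le> (A + A') * exp (- min B B' * real n)" if v: "0 \<le> v" for n v
  proof -
    let ?c = "speed (\<lambda>n. \<lfloor>v * real n\<rfloor>)"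
    let ?S = "{\<omega> \<in> space (config G). crossing_time \<omega> n \<lfloor>v * real n\<rfloor> \<le> real n * (?c - \<epsilon> / 2)}"
    let ?S' = "{\<omega> \<in> space (config G). \<epsilon> / 2 * real n \<le> backlog (column_weights \<omega>) \<lfloor>v * real n\<rfloor> n}"
    have "\<omega> \<in> ?S \<union> ?S'" if "\<omega> \<in> space (config G)" "passage_dir \<omega> (0, 0) (endpoint v n) \<le> real n * (?c - \<epsilon>)" for \<omega>
    proof (rule ccontr)
      assume "\<not> \<omega> \<in> ?S \<union> ?S'"
      then have "real n * (?c - \<epsilon> / 2) < crossing_time \<omega> n \<lfloor>v * real n\<rfloor>"
        "backlog (column_weights \<omega>) \<lfloor>v * real n\<rfloor> n < \<epsilon> / 2 * real n"
        using that by auto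
      then show False
        using floor_le_passage_dir[OF that(1) v, of n] that(2) by (simp add: algebra_simps)
    qed
    then have "prob {\<omega> \<in> space (config G). passage_dir \<omega> (0, 0) (endpoint v n) \<le> real n * (?c - \<epsilon>)} \<le> prob (?S \<union> ?S')"
      by (intro finite_measure_mono) auto
    also have "\<dots> \<le> prob ?S + prob ?S'" by (intro measure_Un_le) measurable
    also have "\<dots> \<le> A * exp (- B * real n) + A' * exp (- B' * real n)"
      using AB(3)[OF slope_floor[OF v]] AB'(3) by (rule add_mono)
    also have "\<dots> \<le> A * exp (- min B B' * real n) + A' * exp (- min B B' * real n)"
      using AB(1) AB'(1) by (intro add_mono mult_left_mono exp_le_cancel_iff[THEN iffD2] mult_right_mono) auto
    finally show ?thesis by (simp add: distrib_right)
  qed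
  moreover have "0 < A + A'" "0 < min B B'" using AB AB' by auto
  ultimately show ?thesis by blast
qed

lemma passage_dir_upper_tail_speed:
  assumes "0 < \<epsilon>" "0 \<le> v"
  shows "\<exists>B>0. \<forall>\<^sub>F n in sequentially. measure (config G) {\<omega> \<in> space (config G).
    real n * (speed (\<lambda>n. \<lfloor>v * real n\<rfloor>) + \<epsilon>) \<le> passage_dir \<omega> (0, 0) (endpoint v n)} \<le> exp (- B * real n)"
proof -
  interpret prob_space "config G" by (rule prob_space_config)
  let ?c = "speed (\<lambda>n. \<lfloor>v * real n\<rfloor>)"
  obtain B where B: "0 < B" "\<forall>\<^sub>F n in sequentially.
    prob {\<omega> \<in> space (config G). real n * (?c + \<epsilon> / 2) \<le> crossing_time \<omega> n \<lfloor>v * real n\<rfloor>} \<le> exp (- B * real n)"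
    using upper_tail[OF _ slope_floor[OF assms(2)], of "\<epsilon> / 2"] assms(1) by auto
  \<comment> \<open>For such \<open>n\<close> the single extra vertical edge costs at most
    \<open>\<epsilon> / 2 * real n\<close>.\<close>
  have "\<forall>\<^sub>F n in sequentially. 2 / \<epsilon> \<le> real n"
    using filterlim_real_sequentially by (simp add: filterlim_at_top)
  with B(2) have "\<forall>\<^sub>F n in sequentially. prob {\<omega> \<in> space (config G).
    real n * (?c + \<epsilon>) \<le> passage_dir \<omega> (0, 0) (endpoint v n)} \<le> exp (- B * real n)"
  proof eventually_elim
    case (elim n)
    have n: "1 \<le> \<epsilon> / 2 * real n" using elim(2) assms(1) by (simp add: field_simps)
    have "real n * (?c + \<epsilon> / 2) \<le> crossing_time \<omega> n \<lfloor>v * real n\<rfloor>"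
      if "\<omega> \<in> space (config G)" "real n * (?c + \<epsilon>) \<le> passage_dir \<omega> (0, 0) (endpoint v n)" for \<omega>
      using passage_dir_le_floor[OF that(1) assms(2), of n] that(2) n by (simp add: algebra_simps)
    then have "prob {\<omega> \<in> space (config G). real n * (?c + \<epsilon>) \<le> passage_dir \<omega> (0, 0) (endpoint v n)}
      \<le> prob {\<omega> \<in> space (config G). real n * (?c + \<epsilon> / 2) \<le> crossing_time \<omega> n \<lfloor>v * real n\<rfloor>}"
      by (intro finite_measure_mono) auto
    then show ?case using elim(1) by linarith
  qed
  then show ?thesis using B(1) by blast
qed

text \<open>Both tails for the ceiling endpoints are centred at the speed along floors, so the
  almost sure limit defining \<open>Lambda_dir\<close> is that speed.\<close>

lemma Lambda_dir_eq_speed: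
  assumes v: "0 \<le> v"
  shows "Lambda_dir G v = speed (\<lambda>n. \<lfloor>v * real n\<rfloor>)"
proof -
  interpret prob_space "config G" by (rule prob_space_config)
  show ?thesis
    unfolding Lambda_dir_def
  proof (rule THE_AE_limit, rule AE_tendsto_if_exponential_tails)
    fix \<epsilon> :: real assume \<epsilon>: "0 < \<epsilon>"
    let ?c = "speed (\<lambda>n. \<lfloor>v * real n\<rfloor>)"
    obtain A B where "0 < B" "\<And>n. prob {\<omega> \<in> space (config G).
        passage_dir \<omega> (0, 0) (endpoint v n) \<le> real n * (?c - \<epsilon>)} \<le> A * exp (- B * real n)"
      using passage_dir_lower_tail_speed[OF \<epsilon>] v by blast
    then show "\<exists>A. \<exists>B>0. \<forall>\<^sub>F n in sequentially. prob {\<omega> \<in> space (config G).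
        passage_dir \<omega> (0, 0) (endpoint v n) \<le> real n * (?c - \<epsilon>)} \<le> A * exp (- B * real n)"
      by (intro exI[of _ A] exI[of _ B]) simp
    show "\<exists>A. \<exists>B>0. \<forall>\<^sub>F n in sequentially. prob {\<omega> \<in> space (config G).
        real n * (?c + \<epsilon>) \<le> passage_dir \<omega> (0, 0) (endpoint v n)} \<le> A * exp (- B * real n)"
      using passage_dir_upper_tail_speed[OF \<epsilon> v] by - (rule exI[of _ 1], simp only: mult_1)
  qed (rule passage_dir_measurable[OF v])
qed

lemma passage_dir_lower_tail:
  assumes "0 < \<epsilon>"
  shows "\<exists>A>0. \<exists>B>0. \<forall>n v. 0 \<le> v \<longrightarrow> measure (config G) {\<omega> \<in> space (config G).
    passage_dir \<omega> (0, 0) (endpoint v n) \<le> real n * (Lambda_dir G v - \<epsilon>)} \<le> A * exp (- B * real n)"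
  using passage_dir_lower_tail_speed[OF assms] Lambda_dir_eq_speed by simp

end

section \<open>Conclusion for both models\<close>

theorem theorem3p9:
  fixes G :: "real measure"
  assumes "prob_space G"
    and "sets G = sets (restrict_space borel {0::real..})"
  shows "(\<forall>\<epsilon>>0. \<forall>v0\<ge>0. \<exists>A>0. \<exists>B>0. \<forall>n\<ge>1. \<forall>v\<in>{0..v0}.
            measure (config G) {\<omega> \<in> space (config G).
               passage \<omega> (0,0) (endpoint v n) \<le> real n * (Lambda G v - \<epsilon>)}
            \<le> A * exp (- B * real n))
       \<and> ((\<exists>a b. a \<noteq> b \<and> measure G {a, b} = 1 \<and> measure G {a} > 0 \<and> measure G {b} > 0) \<longrightarrow>
          (\<forall>\<epsilon>>0. \<forall>v0\<ge>0. \<exists>A>0. \<exists>B>0. \<forall>n\<ge>1. \<forall>v\<in>{0..v0}.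
            measure (config G) {\<omega> \<in> space (config G).
               passage_dir \<omega> (0,0) (endpoint v n) \<le> real n * (Lambda_dir G v - \<epsilon>)}
            \<le> A * exp (- B * real n)))"
proof -
  interpret weight_law G using assms by (simp add: weight_law_def)
  obtain s \<kappa> where "light_crossings G False s \<kappa>" using light_crossings_undirected by blast
  then interpret U: undirected_light_crossings G s \<kappa> by (simp add: undirected_light_crossings_def)
  have undirected: "\<exists>A>0. \<exists>B>0. \<forall>n\<ge>1. \<forall>v\<in>{0..v0}. measure (config G) {\<omega> \<in> space (config G).
      passage \<omega> (0, 0) (endpoint v n) \<le> real n * (Lambda G v - \<epsilon>)} \<le> A * exp (- B * real n)"
    if "0 < \<epsilon>" for \<epsilon> v0 :: real
    using U.passage_lower_tail[OF that] by blast
  have directed: "\<exists>A>0. \<exists>B>0. \<forall>n\<ge>1. \<forall>v\<in>{0..v0}. measure (config G) {\<omega> \<in> space (config G).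
      passage_dir \<omega> (0, 0) (endpoint v n) \<le> real n * (Lambda_dir G v - \<epsilon>)} \<le> A * exp (- B * real n)"
    if ab: "measure G {a, b} = 1" and "0 < \<epsilon>" for a b \<epsilon> v0 :: real
  proof -
    interpret D: directed_light_crossings G 1 "exp (max a b)"
      using light_crossings_directed[OF ab] by (simp add: directed_light_crossings_def)
    obtain A B where "0 < A" "0 < B" "\<And>n v. 0 \<le> v \<Longrightarrow> measure (config G) {\<omega> \<in> space (config G).
      passage_dir \<omega> (0, 0) (endpoint v n) \<le> real n * (Lambda_dir G v - \<epsilon>)} \<le> A * exp (- B * real n)"
      using D.passage_dir_lower_tail[OF \<open>0 < \<epsilon>\<close>] by blast
    then show ?thesis by (intro exI[of _ A] exI[of _ B]) auto
  qed
  show ?thesis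
  proof (intro conjI impI allI)
    show "\<exists>A>0. \<exists>B>0. \<forall>n\<ge>1. \<forall>v\<in>{0..v0}. measure (config G) {\<omega> \<in> space (config G).
      passage \<omega> (0, 0) (endpoint v n) \<le> real n * (Lambda G v - \<epsilon>)} \<le> A * exp (- B * real n)"
      if "0 < \<epsilon>" for \<epsilon> v0
      using that by (rule undirected)
    show "\<exists>A>0. \<exists>B>0. \<forall>n\<ge>1. \<forall>v\<in>{0..v0}. measure (config G) {\<omega> \<in> space (config G).
      passage_dir \<omega> (0, 0) (endpoint v n) \<le> real n * (Lambda_dir G v - \<epsilon>)} \<le> A * exp (- B * real n)"
      if "\<exists>a b. a \<noteq> b \<and> measure G {a, b} = 1 \<and> measure G {a} > 0 \<and> measure G {b} > 0" "0 < \<epsilon>" for \<epsilon> v0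
      using that directed by blast
  qed
qed

end
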